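(* Let $\mathcal{L}$ be a countable language for continuous logic, let $\mathbb{U}$ be the Urysohn sphere and let $A\colon \mathrm{Mod}(\mathcal{L},\mathbb{U})\to[0,1]$ be a Borel grey subset of $\mathrm{Mod}(\mathcal{L},\mathbb{U})$ which is $\mathrm{Iso}(\mathbb{U})$-invariant, i.e. $A(gM)=A(M)$ for all $g\in\mathrm{Iso}(\mathbb{U})$ and $M\in\mathrm{Mod}(\mathcal{L},\mathbb{U})$. Then there exists a sentence $\phi$ of $\mathcal{L}_{\omega_1\omega}$ such that $A(M)=\phi^M$ for all $M\in \mathrm{Mod}(\mathcal{L},\mathbb{U})$.
   Context: Continuous logic: a language $\mathcal{L}$ consists of function symbols and relation symbols, each with a finite arity and a modulus of continuity $\varpi\colon\mathbb{R}_+\to\mathbb{R}_+$ (continuous, vanishing at $0$). A metric $\mathcal{L}$-structure $M$ is a complete metric space together with interpretations $f^M\colon M^{n_f}\to M$ and $R^M\colon M^{n_R}\to[0,1]$ which are uniformly continuous with the given moduli (finite powers carry the maximum metric). Formulas of $\mathcal{L}_{\omega_1\omega}$: atomic formulas are built from terms using relation symbols and the metric symbol $d$; formulas are closed under continuous connectives $h\colon[0,1]^n\to[0,1]$, the quantifiers $\sup_x,\inf_x$, and countable $\inf_n\phi_n$, $\sup_n\phi_n$ provided the $\phi_n$ together have only finitely many free variables and their moduli of continuity are uniformly bounded. For a sentence $\phi$, $\phi^M\in[0,1]$ is its value in $M$ (value $0$ means "true"). The Urysohn sphere $\mathbb{U}$ is the unique separable complete ultrahomogeneous metric space of diameter $\le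 1$ containing an isometric copy of every separable metric space of diameter $\le 1$. $\mathrm{Iso}(\mathbb{U})$ is its isometry group with the topology of pointwise convergence. $\mathrm{Mod}(\mathcal{L},\mathbb{U})=\prod_f \mathrm{Unif}_{\varpi_f}(\mathbb{U}^{n_f},\mathbb{U})\times\prod_R\mathrm{Unif}_{\varpi_R}(\mathbb{U}^{n_R},[0,1])$ is the Polish space of $\mathcal{L}$-structures with support $\mathbb{U}$ (pointwise convergence topology), on which $\mathrm{Iso}(\mathbb{U})$ acts by transport of structure: $f^{gM}(\bar y)=g f^M(g^{-1}\bar y)$, $R^{gM}(\bar y)=R^M(g^{-1}\bar y)$. A grey subset of a space $X$ is a function $X\to[0,1]$; it is Borel if it is Borel measurable. *)

theory Defs
  imports "HOL-Analysis.Analysis"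
begin

section \<open>The Urysohn sphere\<close>

definition Iso :: "('u::metric_space \<Rightarrow> 'u) set" where
  "Iso = {g. bij g \<and> (\<forall>x y. dist (g x) (g y) = dist x y)}"

definition ultrahomogeneous :: "'u::metric_space itself \<Rightarrow> bool" where
  "ultrahomogeneous _ \<longleftrightarrow>
     (\<forall>F (h :: 'u \<Rightarrow> 'u). finite F \<and> (\<forall>x\<in>F. \<forall>y\<in>F. dist (h x) (h y) = dist x y)
        \<longrightarrow> (\<exists>g\<in>Iso. \<forall>x\<in>F. g x = h x))"

text \<open>A separable metric space has at most continuum many points, so up to isometry all of them
  have a subset of \<open>real\<close> as carrier; \<open>d\<close> is an arbitrary metric on that set, unrelated to the
  usual one.\<close>

definition separably_universal :: "'u::metric_space itself \<Rightarrow> bool" where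
  "separably_universal _ \<longleftrightarrow>
     (\<forall>(S :: real set) d. Metric_space S d \<and> separable_space (Metric_space.mtopology S d)
          \<and> (\<forall>x\<in>S. \<forall>y\<in>S. d x y \<le> 1)
        \<longrightarrow> (\<exists>h :: real \<Rightarrow> 'u. \<forall>x\<in>S. \<forall>y\<in>S. dist (h x) (h y) = d x y))"

text \<open>Completeness and separability are part of the class \<open>polish_space\<close>, which refers to the
  given metric.\<close>

definition urysohn_sphere :: "'u::polish_space itself \<Rightarrow> bool" where
  "urysohn_sphere T \<longleftrightarrow>
     (\<forall>x y :: 'u. dist x y \<le> 1) \<and> ultrahomogeneous T \<and> separably_universal T"

section \<open>Languages and structures\<close>

definition modulus :: "(real \<Rightarrow> real) \<Rightarrow> bool" where
  "modulus w \<longleftrightarrow> continuous_on {0..} w \<and> w 0 = 0 \<and> (\<forall>t\<ge>0. 0 \<le> w t)"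

record ('f, 'r) lang =
  Funs :: "'f set"
  Rels :: "'r set"
  far :: "'f \<Rightarrow> nat"
  rar :: "'r \<Rightarrow> nat"
  fmod :: "'f \<Rightarrow> real \<Rightarrow> real"
  rmod :: "'r \<Rightarrow> real \<Rightarrow> real"

definition language :: "('f, 'r) lang \<Rightarrow> bool" where
  "language L \<longleftrightarrow> (\<forall>f\<in>Funs L. modulus (fmod L f)) \<and> (\<forall>r\<in>Rels L. modulus (rmod L r))"

definition countable_language :: "('f, 'r) lang \<Rightarrow> bool" where
  "countable_language L \<longleftrightarrow> language L \<and> countable (Funs L) \<and> countable (Rels L)"

text \<open>The power \<open>A\<^sup>n\<close> is the set of extensional functions on \<open>{..<n}\<close>.\<close>

abbreviation tuples :: "nat \<Rightarrow> 'a set \<Rightarrow> (nat \<Rightarrow> 'a) set" where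
  "tuples n A \<equiv> {..<n} \<rightarrow>\<^sub>E A"

definition tuple :: "'a list \<Rightarrow> nat \<Rightarrow> 'a" where
  "tuple xs = (\<lambda>i\<in>{..<length xs}. xs ! i)"

text \<open>The element 0 only matters for \<open>n = 0\<close>.\<close>

definition max_dist :: "nat \<Rightarrow> (nat \<Rightarrow> 'u::metric_space) \<Rightarrow> (nat \<Rightarrow> 'u) \<Rightarrow> real" where
  "max_dist n x y = Max (insert 0 ((\<lambda>i. dist (x i) (y i)) ` {..<n}))"

definition Unif ::
    "(real \<Rightarrow> real) \<Rightarrow> nat \<Rightarrow> 'b set \<Rightarrow> ((nat \<Rightarrow> 'u::metric_space) \<Rightarrow> 'b::metric_space) set" where
  "Unif w n B = {F \<in> tuples n UNIV \<rightarrow>\<^sub>E B.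
     \<forall>x\<in>tuples n UNIV. \<forall>y\<in>tuples n UNIV. dist (F x) (F y) \<le> w (max_dist n x y)}"

text \<open>The topology of this type is the product topology; on \<open>Mod L\<close>, whose members are
  constant outside the symbols and tuples that matter, it induces pointwise convergence.\<close>

type_synonym ('f, 'r, 'u) struct = "('f \<Rightarrow> (nat \<Rightarrow> 'u) \<Rightarrow> 'u) \<times> ('r \<Rightarrow> (nat \<Rightarrow> 'u) \<Rightarrow> real)"

definition Mod :: "('f, 'r) lang \<Rightarrow> ('f, 'r, 'u::metric_space) struct set" where
  "Mod L = (\<Pi>\<^sub>E f\<in>Funs L. Unif (fmod L f) (far L f) UNIV)
         \<times> (\<Pi>\<^sub>E r\<in>Rels L. Unif (rmod L r) (rar L r) {0..1})"

definition pull :: "('u \<Rightarrow> 'u) \<Rightarrow> nat \<Rightarrow> (nat \<Rightarrow> 'u) \<Rightarrow> (nat \<Rightarrow> 'u)" where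
  "pull g n y = (\<lambda>i\<in>{..<n}. inv g (y i))"

definition act ::
    "('f, 'r) lang \<Rightarrow> ('u \<Rightarrow> 'u) \<Rightarrow> ('f, 'r, 'u) struct \<Rightarrow> ('f, 'r, 'u) struct" where
  "act L g M =
     ((\<lambda>f\<in>Funs L. \<lambda>y\<in>tuples (far L f) UNIV. g (fst M f (pull g (far L f) y))),
      (\<lambda>r\<in>Rels L. \<lambda>y\<in>tuples (rar L r) UNIV. snd M r (pull g (rar L r) y)))"

section \<open>Formulas of \<open>L_{\<omega>_1 \<omega>}\<close>\<close>

datatype 'f tm = Var nat | App 'f "'f tm list"

datatype ('f, 'r) fm =
    Dist "'f tm" "'f tm"
  | Rel 'r "'f tm list"
  | Conn "(nat \<Rightarrow> real) \<Rightarrow> real" "('f, 'r) fm list"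
  | SupV nat "('f, 'r) fm"
  | InfV nat "('f, 'r) fm"
  | SupN "nat \<Rightarrow> ('f, 'r) fm"
  | InfN "nat \<Rightarrow> ('f, 'r) fm"

primrec tm_fv :: "'f tm \<Rightarrow> nat set" where
  "tm_fv (Var x) = {x}"
| "tm_fv (App f ts) = \<Union> (set (map tm_fv ts))"

primrec fv :: "('f, 'r) fm \<Rightarrow> nat set" where
  "fv (Dist s t) = tm_fv s \<union> tm_fv t"
| "fv (Rel r ts) = \<Union> (set (map tm_fv ts))"
| "fv (Conn h ps) = \<Union> (set (map fv ps))"
| "fv (SupV x p) = fv p - {x}"
| "fv (InfV x p) = fv p - {x}"
| "fv (SupN ps) = (\<Union>n. fv (ps n))"
| "fv (InfN ps) = (\<Union>n. fv (ps n))"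

text \<open>Moduli of continuity of terms and formulas, computed by recursion: if \<open>D x\<close> bounds the
  distance between the values of the variable \<open>x\<close> under two assignments, \<open>fm_mod L p D\<close> bounds the
  difference of the values of \<open>p\<close>, in every structure. The modulus of \<open>p\<close> for the
  maximum metric is \<open>\<lambda>t. fm_mod L p (\<lambda>_. t)\<close>. Keeping the variables apart lets a quantifier
  discard the contribution of the variable it binds. The moduli of the symbols need not be
  monotone, whence the supremum in \<open>mono_mod\<close>.\<close>

definition mono_mod :: "(real \<Rightarrow> real) \<Rightarrow> real \<Rightarrow> real" where
  "mono_mod w t = (SUP s\<in>{0..t}. w s)"

definition max0 :: "real list \<Rightarrow> real" where
  "max0 xs = Max (insert 0 (set xs))"

definition conn_mod :: "((nat \<Rightarrow> real) \<Rightarrow> real) \<Rightarrow> real list \<Rightarrow> real" where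
  "conn_mod h ds = Sup {\<bar>h x - h y\<bar> | x y.
     x \<in> tuples (length ds) {0..1} \<and> y \<in> tuples (length ds) {0..1}
     \<and> (\<forall>i<length ds. \<bar>x i - y i\<bar> \<le> ds ! i)}"

primrec tm_mod :: "('f, 'r) lang \<Rightarrow> (nat \<Rightarrow> real) \<Rightarrow> 'f tm \<Rightarrow> real" where
  "tm_mod L D (Var x) = D x"
| "tm_mod L D (App f ts) = mono_mod (fmod L f) (max0 (map (tm_mod L D) ts))"

primrec fm_mod :: "('f, 'r) lang \<Rightarrow> ('f, 'r) fm \<Rightarrow> (nat \<Rightarrow> real) \<Rightarrow> real" where
  "fm_mod L (Dist s t) D = tm_mod L D s + tm_mod L D t"
| "fm_mod L (Rel r ts) D = mono_mod (rmod L r) (max0 (map (tm_mod L D) ts))"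
| "fm_mod L (Conn h ps) D = conn_mod h (map (\<lambda>p. fm_mod L p D) ps)"
| "fm_mod L (SupV x p) D = fm_mod L p (D(x := 0))"
| "fm_mod L (InfV x p) D = fm_mod L p (D(x := 0))"
| "fm_mod L (SupN ps) D = (SUP n. fm_mod L (ps n) D)"
| "fm_mod L (InfN ps) D = (SUP n. fm_mod L (ps n) D)"

definition uniformly_bounded_moduli :: "('f, 'r) lang \<Rightarrow> (nat \<Rightarrow> ('f, 'r) fm) \<Rightarrow> bool" where
  "uniformly_bounded_moduli L ps \<longleftrightarrow>
     (\<exists>w. modulus w \<and> (\<forall>n. \<forall>t\<ge>0. fm_mod L (ps n) (\<lambda>_. t) \<le> w t))"

definition connective :: "nat \<Rightarrow> ((nat \<Rightarrow> real) \<Rightarrow> real) \<Rightarrow> bool" where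
  "connective n h \<longleftrightarrow>
     continuous_on (tuples n {0..1}) h \<and> h ` tuples n {0..1} \<subseteq> {0..1}"

inductive is_term :: "('f, 'r) lang \<Rightarrow> 'f tm \<Rightarrow> bool" for L where
  "is_term L (Var x)"
| "\<lbrakk>f \<in> Funs L; length ts = far L f; \<forall>t\<in>set ts. is_term L t\<rbrakk> \<Longrightarrow> is_term L (App f ts)"

inductive formula :: "('f, 'r) lang \<Rightarrow> ('f, 'r) fm \<Rightarrow> bool" for L where
  "\<lbrakk>is_term L s; is_term L t\<rbrakk> \<Longrightarrow> formula L (Dist s t)"
| "\<lbrakk>r \<in> Rels L; length ts = rar L r; \<forall>t\<in>set ts. is_term L t\<rbrakk> \<Longrightarrow> formula L (Rel r ts)"
| "\<lbrakk>connective (length ps) h; \<forall>p\<in>set ps. formula L p\<rbrakk> \<Longrightarrow> formula L (Conn h ps)"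
| "formula L p \<Longrightarrow> formula L (SupV x p)"
| "formula L p \<Longrightarrow> formula L (InfV x p)"
| "\<lbrakk>\<forall>n. formula L (ps n); finite (\<Union>n. fv (ps n)); uniformly_bounded_moduli L ps\<rbrakk>
     \<Longrightarrow> formula L (SupN ps)"
| "\<lbrakk>\<forall>n. formula L (ps n); finite (\<Union>n. fv (ps n)); uniformly_bounded_moduli L ps\<rbrakk>
     \<Longrightarrow> formula L (InfN ps)"

definition sentence :: "('f, 'r) lang \<Rightarrow> ('f, 'r) fm \<Rightarrow> bool" where
  "sentence L p \<longleftrightarrow> formula L p \<and> fv p = {}"

primrec tm_val :: "('f, 'r, 'u) struct \<Rightarrow> (nat \<Rightarrow> 'u) \<Rightarrow> 'f tm \<Rightarrow> 'u" where
  "tm_val M e (Var x) = e x"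
| "tm_val M e (App f ts) = fst M f (tuple (map (tm_val M e) ts))"

primrec fm_val :: "('f, 'r, 'u::metric_space) struct \<Rightarrow> ('f, 'r) fm \<Rightarrow> (nat \<Rightarrow> 'u) \<Rightarrow> real" where
  "fm_val M (Dist s t) e = dist (tm_val M e s) (tm_val M e t)"
| "fm_val M (Rel r ts) e = snd M r (tuple (map (tm_val M e) ts))"
| "fm_val M (Conn h ps) e = h (tuple (map (\<lambda>p. fm_val M p e) ps))"
| "fm_val M (SupV x p) e = (SUP a. fm_val M p (e(x := a)))"
| "fm_val M (InfV x p) e = (INF a. fm_val M p (e(x := a)))"
| "fm_val M (SupN ps) e = (SUP n. fm_val M (ps n) e)"
| "fm_val M (InfN ps) e = (INF n. fm_val M (ps n) e)"

section \<open>Borel grey subsets\<close>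

text \<open>The trace of the Borel sets of the ambient type on \<open>X\<close> is the Borel algebra of the
  subspace \<open>X\<close>, also when the ambient space is not second countable.\<close>

definition borel_grey_subset :: "'a::topological_space set \<Rightarrow> ('a \<Rightarrow> real) \<Rightarrow> bool" where
  "borel_grey_subset X A \<longleftrightarrow>
     A \<in> X \<rightarrow> {0..1} \<and> A \<in> borel_measurable (restrict_space borel X)"

end

theory Submission
  imports Defs
begin

text \<open>By invariance every sublevel set \<open>{A < q}\<close> is an invariant Borel set, and \<open>A\<close> is the infimum over
  rational \<open>q\<close> of the functions equal to \<open>q\<close> on \<open>{A < q}\<close> and to 1 elsewhere; so it suffices to define
  0-1 valued sentences for invariant Borel sets. For a Borel set \<open>B\<close>, a dense sequence \<open>p\<close> and
  \<open>u\<^sub>0, \<dots>, u\<^sub>k\<^sub>-\<^sub>1\<close> consider the Vaught transform: the essential infimum, in the sense of Baire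
  category on the isometry group, of \<open>N * (\<Sum>i<k. d (g u\<^sub>i) p\<^sub>i)\<close> over the \<open>g\<close> with \<open>gM \<in> B\<close>. It is
  definable by a formula in \<open>u\<close>, by induction on \<open>B\<close>. Countable unions become countable infima. For the
  complement, the property of Baire shows that \<open>gM \<notin> B\<close> for nonmeagerly many \<open>g\<close> in an open set iff
  \<open>gM \<in> B\<close> only for meagerly many \<open>g\<close> in some smaller basic open set, given by a tuple \<open>v\<close> that is
  to be moved close to an initial segment of \<open>p\<close>; one quantifies over all \<open>v\<close>, and those not isometric
  to that segment are penalised by their discrepancy, which by approximate homogeneity of the Urysohn
  sphere bounds the distance to which \<open>v\<close> can be moved onto it. For \<open>k = 0\<close> and invariant \<open>B\<close> the
  transform is 0 on \<open>B\<close> and 1 elsewhere.\<close>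

subsection \<open>Meager sets and the property of Baire\<close>

text \<open>The main obstacle is syntactic: a countable infimum is a formula only if the moduli
  computed for its members have a common bound, while the formulas used for complements carry
  arbitrarily large constants \<open>K\<close>. Hence \<open>u\<close> is never inserted into such a
  formula. It is evaluated at quantified variables \<open>v\<close>, which add nothing to the
  computed modulus, and only \<open>N * (\<Sum>i<k. d u_i v_i)\<close> ties \<open>u\<close> to
  \<open>v\<close>. So every step ends with the bound \<open>N * k * t\<close>, the Lipschitz bound
  of the function whose essential infimum is taken, and can be iterated through the Borel hierarchy.
  The penalty on a tuple of discrepancy \<Delta> has two parts: \<open>N * k * \<Delta>\<close> pays
  for the error in the \<open>k\<close> distances to \<open>p\<close>, and
  \<open>C * \<Delta>\<close> ensures that the information carried by the inner formula survives
  that error. Transforms are described by strict sublevel sets because these suit both infima (a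
  value below \<open>r\<close> is witnessed by one member) and category (a countable union is
  nonmeager iff one member is).\<close>

definition meager :: "'a topology \<Rightarrow> 'a set \<Rightarrow> bool" where
  "meager X S \<longleftrightarrow>
     (\<exists>\<G>. countable \<G> \<and> (\<forall>T\<in>\<G>. closedin X T \<and> X interior_of T = {}) \<and> S \<subseteq> \<Union>\<G>)"

lemma meager_subset: "meager X T \<Longrightarrow> S \<subseteq> T \<Longrightarrow> meager X S"
  unfolding meager_def by (meson subset_trans)

lemma meager_empty [simp]: "meager X {}"
  unfolding meager_def by (rule exI[of _ "{}"]) auto

lemma meager_UN:
  assumes "\<And>n::nat. meager X (S n)"
  shows "meager X (\<Union>n. S n)"
proof -
  have "\<exists>\<G>. \<forall>n. countable (\<G> n) \<and> (\<forall>T\<in>\<G> n. closedin X T \<and> X interior_of T = {}) \<and> S n \<subseteq> \<Union>(\<G> n)"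
    using assms unfolding meager_def by (intro choice) auto
  then obtain \<G>
    where \<G>: "\<forall>n. countable (\<G> n) \<and> (\<forall>T\<in>\<G> n. closedin X T \<and> X interior_of T = {}) \<and> S n \<subseteq> \<Union>(\<G> n)"
    by (rule exE)
  have sub: "S n \<subseteq> \<Union>(\<G> n)" for n using \<G> by simp
  have "(\<Union>n. S n) \<subseteq> \<Union>(\<Union>n. \<G> n)"
  proof
    fix x assume "x \<in> (\<Union>n. S n)"
    then obtain n where "x \<in> S n" by (rule UN_E)
    with sub[of n] obtain T where "T \<in> \<G> n" "x \<in> T" by (rule subsetD[THEN UnionE])
    then show "x \<in> \<Union>(\<Union>n. \<G> n)" by (intro UnionI[OF UN_I[OF UNIV_I]])
  qed
  with \<G> show ?thesis
    unfolding meager_def by (intro exI[of _ "\<Union>n. \<G> n"]) simp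
qed

lemma meager_Un:
  assumes "meager X S" "meager X T"
  shows "meager X (S \<union> T)"
proof -
  have "meager X (\<Union>n::nat. if n = 0 then S else T)"
    using assms by (intro meager_UN) auto
  then show ?thesis
    by (rule meager_subset) (auto split: if_splits)
qed

lemma open_not_meager:
  assumes "completely_metrizable_space X" "openin X U" "U \<noteq> {}"
  shows "\<not> meager X U"
proof
  assume "meager X U"
  then obtain \<G> where \<G>: "countable \<G>" "\<And>T. T \<in> \<G> \<Longrightarrow> closedin X T \<and> X interior_of T = {}" "U \<subseteq> \<Union>\<G>"
    unfolding meager_def by blast
  then have "X interior_of \<Union>\<G> = {}"
    using assms(1) by (intro Baire_category_alt) auto
  then show False
    using interior_of_maximal[OF \<G>(3) assms(2)] assms(3) by blast
qed

definition almost_open :: "'a topology \<Rightarrow> 'a set \<Rightarrow> bool" where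
  "almost_open X S \<longleftrightarrow> (\<exists>U. openin X U \<and> meager X ((S - U) \<union> (U - S)))"

lemma openin_imp_almost_open: "openin X S \<Longrightarrow> almost_open X S"
  unfolding almost_open_def by (rule exI[of _ S]) simp

lemma almost_open_UN:
  assumes "\<And>n::nat. almost_open X (S n)"
  shows "almost_open X (\<Union>n. S n)"
proof -
  obtain U where U: "\<And>n. openin X (U n)" "\<And>n. meager X ((S n - U n) \<union> (U n - S n))"
    using assms unfolding almost_open_def by metis
  have "meager X (((\<Union>n. S n) - (\<Union>n. U n)) \<union> ((\<Union>n. U n) - (\<Union>n. S n)))"
    by (rule meager_subset[OF meager_UN[OF U(2)]]) auto
  then show ?thesis
    unfolding almost_open_def using U(1) by (intro exI[of _ "\<Union>n. U n"]) auto
qed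

text \<open>If \<open>U\<close> approximates \<open>S\<close>, then the exterior of \<open>U\<close>
  approximates the complement. The only new error is the boundary of \<open>U\<close>, which is
  nowhere dense because \<open>U\<close> is open.\<close>

lemma almost_open_compl:
  assumes "almost_open X S"
  shows "almost_open X (topspace X - S)"
proof -
  obtain U where U: "openin X U" "meager X ((S - U) \<union> (U - S))"
    using assms unfolding almost_open_def by blast
  let ?F = "X frontier_of U"
  \<comment> \<open>An open set that misses \<open>U\<close> misses the closure of \<open>U\<close>,
    and the closure contains the boundary.\<close>
  have "X interior_of ?F \<inter> U = {}"
    using U(1) interior_of_subset[of X ?F] by (auto simp: frontier_of_openin)
  then have "X interior_of ?F \<inter> X closure_of U = {}"
    by (simp add: openin_Int_closure_of_eq_empty)
  then have "X interior_of ?F = {}"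
    using interior_of_subset[of X ?F] by (auto simp: frontier_of_def)
  then have "meager X ?F"
    unfolding meager_def by (intro exI[of _ "{?F}"]) (auto simp: closedin_frontier_of)
  then have F: "meager X (((S - U) \<union> (U - S)) \<union> ?F)"
    by (rule meager_Un[OF U(2)])
  have "U \<subseteq> topspace X" "X interior_of U = U"
    using U(1) by (auto dest: openin_subset simp: interior_of_openin)
  moreover have "U \<subseteq> X closure_of U"
    by (rule closure_of_subset) fact
  ultimately have "meager X (((topspace X - S) - (topspace X - X closure_of U)) \<union>
      ((topspace X - X closure_of U) - (topspace X - S)))"
    by (intro meager_subset[OF F]) (auto simp: frontier_of_def)
  then show ?thesis
    unfolding almost_open_def by (intro exI[of _ "topspace X - X closure_of U"]) auto
qed

text \<open>The open set \<open>U\<close> approximating \<open>S\<close> must meet \<open>V\<close>,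
  since otherwise \<open>S \<inter> V\<close> would lie in the meager set \<open>S - U\<close>. The
  witness is \<open>U \<inter> V\<close>.\<close>

lemma almost_open_localize:
  assumes "almost_open X S" "openin X V" "\<not> meager X (S \<inter> V)"
  obtains W where "openin X W" "W \<noteq> {}" "W \<subseteq> V" "meager X (W - S)"
proof -
  obtain U where U: "openin X U" "meager X ((S - U) \<union> (U - S))"
    using assms unfolding almost_open_def by blast
  show thesis
  proof
    show "openin X (U \<inter> V)" using U(1) assms(2) by blast
    show "U \<inter> V \<noteq> {}"
      using assms(3) meager_subset[OF U(2), of "S \<inter> V"] by blast
    show "meager X (U \<inter> V - S)"
      by (rule meager_subset[OF U(2)]) auto
  qed auto
qed

subsection \<open>The Polish topology on the isometry group\<close>

lemma Iso_dist: "g \<in> Iso \<Longrightarrow> dist (g x) (g y) = dist x y"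
  and Iso_bij: "g \<in> Iso \<Longrightarrow> bij g"
  by (auto simp: Iso_def)

lemma Iso_inv [simp]: "g \<in> Iso \<Longrightarrow> inv g (g x) = x"
  and Iso_inv' [simp]: "g \<in> Iso \<Longrightarrow> g (inv g x) = x"
  by (auto simp: Iso_bij bij_is_inj bij_is_surj surj_f_inv_f)

lemma Iso_dist_inv: "g \<in> Iso \<Longrightarrow> dist x (inv g y) = dist (g x) y"
  by (metis Iso_dist Iso_inv')

lemma Iso_dist_inv': "g \<in> Iso \<Longrightarrow> dist (inv g y) x = dist y (g x)"
  by (metis Iso_dist Iso_inv')

lemma id_in_Iso: "id \<in> Iso"
  by (auto simp: Iso_def)

lemma inv_in_Iso: "g \<in> Iso \<Longrightarrow> inv g \<in> Iso"
  unfolding Iso_def mem_Collect_eq by (metis bij_imp_bij_inv bij_inv_eq_iff)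

lemma comp_in_Iso: "g \<in> Iso \<Longrightarrow> h \<in> Iso \<Longrightarrow> g \<circ> h \<in> Iso"
  by (auto simp: Iso_def intro: bij_comp)

definition dense_seq :: "(nat \<Rightarrow> 'u::metric_space) \<Rightarrow> bool" where
  "dense_seq p \<longleftrightarrow> (\<forall>x. \<forall>\<epsilon>>0. \<exists>n. dist x (p n) < \<epsilon>)"

lemma dense_seqD: "dense_seq p \<Longrightarrow> \<epsilon> > 0 \<Longrightarrow> \<exists>n. dist x (p n) < \<epsilon>"
  unfolding dense_seq_def by blast

lemma ex_dense_seq: "\<exists>p :: nat \<Rightarrow> 'u::{second_countable_topology, metric_space}. dense_seq p"
proof -
  obtain D :: "'u set" where D: "countable D" "\<And>X. open X \<Longrightarrow> X \<noteq> {} \<Longrightarrow> \<exists>d\<in>D. d \<in> X"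
    by (rule countable_dense_setE) blast
  have "D \<noteq> {}" using D(2)[of UNIV] by auto
  have "\<exists>n. dist x (from_nat_into D n) < \<epsilon>" if e: "\<epsilon> > 0" for x \<epsilon>
  proof -
    obtain d where "d \<in> D" "d \<in> ball x \<epsilon>"
      using D(2)[of "ball x \<epsilon>"] e by (metis open_ball centre_in_ball empty_iff)
    then show ?thesis
      using from_nat_into_surj[OF D(1), of d] by auto
  qed
  then show ?thesis unfolding dense_seq_def by blast
qed

text \<open>Recording the inverse as well makes the image of the embedding closed.\<close>

definition Iso_code :: "(nat \<Rightarrow> 'u::metric_space) \<Rightarrow> ('u \<Rightarrow> 'u) \<Rightarrow> (nat \<Rightarrow> 'u) \<times> (nat \<Rightarrow> 'u)" where
  "Iso_code p g = (g \<circ> p, inv g \<circ> p)"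

definition Iso_top :: "(nat \<Rightarrow> 'u::metric_space) \<Rightarrow> ('u \<Rightarrow> 'u) topology" where
  "Iso_top p = pullback_topology Iso (Iso_code p) euclidean"

lemma topspace_Iso_top [simp]: "topspace (Iso_top p) = Iso"
  by (simp add: Iso_top_def topspace_pullback_topology)

section \<open>Isometries as pairs of sequences; complete metrizability\<close>

lemma dense_seq_eqI:
  assumes "dense_seq p" "g \<in> Iso" "h \<in> Iso" "\<And>n. g (p n) = h (p n)"
  shows "g = h"
proof
  fix x
  have "dist (g x) (h x) \<le> \<epsilon>" if e: "\<epsilon> > 0" for \<epsilon>
  proof -
    obtain n where "dist x (p n) < \<epsilon>/2"
      using assms(1) e by (metis dense_seqD half_gt_zero)
    then have "dist (g x) (g (p n)) < \<epsilon>/2" "dist (h x) (h (p n)) < \<epsilon>/2"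
      unfolding Iso_dist[OF assms(2)] Iso_dist[OF assms(3)] by simp_all
    then have "dist (g x) (g (p n)) < \<epsilon>/2" "dist (h x) (g (p n)) < \<epsilon>/2"
      unfolding assms(4) by simp_all
    then show ?thesis by metric
  qed
  then show "g x = h x" by (metis dist_le_zero_iff dense_ge)
qed

text \<open>Each \<open>x\<close> is a limit of points of \<open>p\<close>; the corresponding points
  of \<open>a\<close> form a Cauchy sequence, and completeness supplies the value at
  \<open>x\<close>.\<close>

lemma isometry_extension:
  fixes p a :: "nat \<Rightarrow> 'u::complete_space"
  assumes "dense_seq p" and a: "\<And>i j. dist (a i) (a j) = dist (p i) (p j)"
  shows "\<exists>g. (\<forall>n. g (p n) = a n) \<and> (\<forall>x y. dist (g x) (g y) = dist x y)"
proof -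
  have "\<forall>x n. \<exists>k. dist x (p k) < 1 / Suc n"
    using assms(1) unfolding dense_seq_def by simp
  then obtain s where s: "\<And>x n. dist x (p (s x n)) < 1 / Suc n"
    by metis
  have lim: "(\<lambda>n. p (s x n)) \<longlonglongrightarrow> x" for x
  proof (rule metric_LIMSEQ_I)
    fix r :: real assume "r > 0"
    then obtain N where N: "1 / Suc N < r" by (metis nat_approx_posE)
    have "dist (p (s x n)) x < r" if "n \<ge> N" for n
    proof -
      have "1 / real (Suc n) \<le> 1 / real (Suc N)" using that by (simp add: frac_le)
      then show ?thesis using s[of x n] N by (simp add: dist_commute)
    qed
    then show "\<exists>no. \<forall>n\<ge>no. dist (p (s x n)) x < r" by blast
  qed
  have "Cauchy (\<lambda>n. a (s x n))" for x
    using LIMSEQ_imp_Cauchy[OF lim[of x]] by (simp add: Cauchy_def a)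
  then have "\<exists>y. (\<lambda>n. a (s x n)) \<longlonglongrightarrow> y" for x
    using Cauchy_convergent[of "\<lambda>n. a (s x n)"] by (simp add: convergent_def)
  then obtain g where g: "\<And>x. (\<lambda>n. a (s x n)) \<longlonglongrightarrow> g x" by metis
  have d: "dist (g x) (g y) = dist x y" for x y
    using LIMSEQ_unique[OF tendsto_dist[OF g[of x] g[of y]]] tendsto_dist[OF lim[of x] lim[of y]]
    by (simp add: a)
  have "g (p n) = a n" for n
  proof -
    have "(\<lambda>k. dist (a (s (p n) k)) (a n)) \<longlonglongrightarrow> dist (p n) (p n)"
      unfolding a by (intro tendsto_dist lim tendsto_const)
    then have "(\<lambda>k. a (s (p n) k)) \<longlonglongrightarrow> a n"
      by (subst tendsto_dist_iff) simp
    then show ?thesis using LIMSEQ_unique[OF g] by blast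
  qed
  with d show ?thesis by (intro exI[of _ g]) simp
qed

text \<open>The mixed equations make the extensions of \<open>a\<close> and \<open>b\<close> inverse
  to each other: if \<open>p i\<close> is near \<open>b n\<close>, then \<open>a i\<close> is near
  \<open>p n\<close>, so the extension of \<open>a\<close> sends \<open>b n\<close> to
  \<open>p n\<close>. All conditions are equations between continuous functions of
  \<open>(a, b)\<close>, so the image is closed.\<close>

lemma Iso_code_image:
  fixes p :: "nat \<Rightarrow> 'u::complete_space"
  assumes p: "dense_seq p"
  shows "Iso_code p ` Iso = {(a, b). (\<forall>i j. dist (a i) (a j) = dist (p i) (p j)) \<and>
     (\<forall>i j. dist (b i) (b j) = dist (p i) (p j)) \<and> (\<forall>i j. dist (a i) (p j) = dist (p i) (b j))}"
    (is "_ = ?R")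
proof
  show "Iso_code p ` Iso \<subseteq> ?R"
    using inv_in_Iso by (auto simp: Iso_code_def Iso_dist Iso_dist_inv)
  show "?R \<subseteq> Iso_code p ` Iso"
  proof clarify
    fix a b
    assume a: "\<forall>i j. dist (a i) (a j) = dist (p i) (p j)"
      and b: "\<forall>i j. dist (b i) (b j) = dist (p i) (p j)"
      and ab: "\<forall>i j. dist (a i) (p j) = dist (p i) (b j)"
    obtain g where g: "\<And>n. g (p n) = a n" "\<And>x y. dist (g x) (g y) = dist x y"
      using isometry_extension[OF p, of a] a by blast
    have gb: "g (b n) = p n" for n
    proof -
      have "dist (g (b n)) (p n) \<le> \<epsilon>" if e: "\<epsilon> > 0" for \<epsilon>
      proof -
        obtain i where i: "dist (b n) (p i) < \<epsilon>/2"
          using p e by (metis dense_seqD half_gt_zero)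
        then have "dist (g (b n)) (a i) < \<epsilon>/2" using g by metis
        moreover have "dist (a i) (p n) < \<epsilon>/2" using ab i by (simp add: dist_commute)
        ultimately show ?thesis by metric
      qed
      then show ?thesis by (metis dist_le_zero_iff dense_ge)
    qed
    obtain h where h: "\<And>n. h (p n) = b n" "\<And>x y. dist (h x) (h y) = dist x y"
      using isometry_extension[OF p, of b] b by blast
    have gh: "g (h x) = x" for x
    proof -
      have "dist (g (h x)) x \<le> \<epsilon>" if e: "\<epsilon> > 0" for \<epsilon>
      proof -
        obtain i where i: "dist x (p i) < \<epsilon>/2"
          using p e by (metis dense_seqD half_gt_zero)
        have "dist (g (h x)) (p i) = dist (g (h x)) (g (h (p i)))" by (simp add: gb h)
        also have "\<dots> = dist x (p i)" by (simp only: g(2) h(2))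
        finally show ?thesis using i by metric
      qed
      then show ?thesis by (metis dist_le_zero_iff dense_ge)
    qed
    have inj: "inj g" by (metis g(2) dist_eq_0_iff injI)
    have "bij g" using inj gh by (metis bijI surjI)
    then have gI: "g \<in> Iso" using g(2) by (simp add: Iso_def)
    moreover have "inv g (p n) = b n" for n
      by (rule inv_f_eq[OF inj gb])
    ultimately have "Iso_code p g = (a, b)"
      by (auto simp: Iso_code_def g)
    with gI show "(a, b) \<in> Iso_code p ` Iso" by (metis image_eqI)
  qed
qed

lemma completely_metrizable_Iso_top:
  fixes p :: "nat \<Rightarrow> 'u::complete_space"
  assumes p: "dense_seq p"
  shows "completely_metrizable_space (Iso_top p)"
proof -
  let ?H = "Iso_code p ` Iso"
  have "closed ?H"
    unfolding Iso_code_image[OF p] case_prod_beta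
    by (intro closed_Collect_conj closed_Collect_all closed_Collect_eq continuous_intros
        continuous_on_product_then_coordinatewise)
  then have H: "completely_metrizable_space (top_of_set ?H)"
    by (intro completely_metrizable_space_closedin completely_metrizable_space_euclidean) simp
  have "homeomorphic_map (Iso_top p) (top_of_set ?H) (Iso_code p)"
  proof (rule bijective_open_imp_homeomorphic_map)
    show "continuous_map (Iso_top p) (top_of_set ?H) (Iso_code p)"
      unfolding Iso_top_def continuous_map_in_subtopology
      using continuous_map_pullback[of euclidean euclidean id Iso "Iso_code p"]
      by (auto simp: topspace_pullback_topology id_comp continuous_map_id)
    show "open_map (Iso_top p) (top_of_set ?H) (Iso_code p)"
      unfolding open_map_def Iso_top_def openin_pullback_topology
      by (auto simp: openin_open)
    show "inj_on (Iso_code p) (topspace (Iso_top p))"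
      using dense_seq_eqI[OF p] by (intro inj_onI) (auto simp: Iso_code_def fun_eq_iff)
  qed auto
  then show ?thesis
    using H homeomorphic_completely_metrizable_space homeomorphic_map_imp_homeomorphic_space by blast
qed

text \<open>By definition the topology controls \<open>g\<close> and its inverse only at the points
  of \<open>p\<close>. Since isometries do not increase distances, control at a nearby
  \<open>p n\<close> gives control at \<open>x\<close>.\<close>

lemma openin_Iso_top_ball:
  fixes p :: "nat \<Rightarrow> 'u::metric_space"
  assumes p: "dense_seq p"
  shows "openin (Iso_top p) {g \<in> Iso. dist (g x) y < r}"
proof (subst openin_subopen, safe)
  fix g0 assume g0: "g0 \<in> Iso" "dist (g0 x) y < r"
  define \<epsilon> where "\<epsilon> = (r - dist (g0 x) y) / 3"
  have "\<epsilon> > 0" using g0 by (simp add: \<epsilon>_def)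
  then obtain n where n: "dist x (p n) < \<epsilon>" using p unfolding dense_seq_def by blast
  let ?V = "{z :: (nat \<Rightarrow> 'u) \<times> (nat \<Rightarrow> 'u). dist (fst z n) (g0 (p n)) < \<epsilon>}"
  have "open ?V"
    by (intro open_Collect_less continuous_intros
        continuous_on_product_then_coordinatewise)
  then have "openin (Iso_top p) (Iso_code p -` ?V \<inter> Iso)"
    unfolding Iso_top_def openin_pullback_topology by auto
  moreover have "g0 \<in> Iso_code p -` ?V \<inter> Iso"
    using g0 \<open>\<epsilon> > 0\<close> by (simp add: Iso_code_def)
  moreover have "dist (g x) y < r" if "g \<in> Iso_code p -` ?V \<inter> Iso" for g
  proof -
    have "dist (g (p n)) (g0 (p n)) < \<epsilon>" using that by (simp add: Iso_code_def)
    moreover have "dist (g x) (g (p n)) < \<epsilon>" "dist (g0 x) (g0 (p n)) < \<epsilon>"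
      using that n g0 by (auto simp: Iso_dist)
    moreover have "dist (g0 x) y = r - 3 * \<epsilon>" by (simp add: \<epsilon>_def field_simps)
    ultimately show ?thesis by metric
  qed
  ultimately show "\<exists>T. openin (Iso_top p) T \<and> g0 \<in> T \<and> T \<subseteq> {g \<in> Iso. dist (g x) y < r}"
    by (intro exI[of _ "Iso_code p -` ?V \<inter> Iso"]) auto
qed

text \<open>Basic neighbourhoods of \<open>h\<close> in the form that a formula can express: the
  tuple with entries \<open>inv h (p i)\<close> is moved close to an initial segment of
  \<open>p\<close>. This controls \<open>inv g\<close> at \<open>p i\<close> directly; for
  \<open>g\<close> at \<open>p n\<close> one passes through a point \<open>p (s n)\<close> near
  \<open>h (p n)\<close>.\<close>

lemma Iso_top_nbhd:
  fixes p :: "nat \<Rightarrow> 'u::metric_space"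
  assumes p: "dense_seq p" and U: "openin (Iso_top p) U" "h \<in> U"
  obtains m \<epsilon> where "\<epsilon> > 0" "\<And>g. g \<in> Iso \<Longrightarrow> \<forall>i<m. dist (g (inv h (p i))) (p i) < \<epsilon> \<Longrightarrow> g \<in> U"
proof -
  have hI: "h \<in> Iso" using openin_subset[OF U(1)] U(2) by auto
  obtain V where V: "open V" "U = Iso_code p -` V \<inter> Iso"
    using U unfolding Iso_top_def openin_pullback_topology by auto
  then have "Iso_code p h \<in> V" using U by auto
  then obtain A B where AB: "open A" "open B" "h \<circ> p \<in> A" "inv h \<circ> p \<in> B" "A \<times> B \<subseteq> V"
    using V(1) by (metis open_prod_elim Iso_code_def mem_Sigma_iff)
  have nb: "\<exists>n \<epsilon>. \<epsilon> > 0 \<and> (\<forall>b. (\<forall>i<n. dist (b i) (a i) < \<epsilon>) \<longrightarrow> b \<in> S)"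
    if S: "open S" "a \<in> S" for S and a :: "nat \<Rightarrow> 'u"
  proof -
    have "openin (product_topology (\<lambda>i. euclidean) UNIV) S"
      using S(1) by (simp add: euclidean_product_topology)
    from product_topology_open_contains_basis[OF this S(2)]
    obtain X where X: "a \<in> (\<Pi>\<^sub>E i\<in>UNIV. X i)" "\<And>i. open (X i)" "finite {i. X i \<noteq> UNIV}"
        "(\<Pi>\<^sub>E i\<in>UNIV. X i) \<subseteq> S"
      unfolding open_openin[symmetric] topspace_euclidean by metis
    obtain n where "{i. X i \<noteq> UNIV} \<subseteq> {..<n}"
      using finite_nat_bounded[OF X(3)] by (rule exE)
    then have n: "X i \<noteq> UNIV \<Longrightarrow> i < n" for i by (auto simp: subset_eq)
    have "\<forall>i. \<exists>e>0. ball (a i) e \<subseteq> X i"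
      using X(1,2) by (meson PiE_E UNIV_I open_contains_ball)
    then obtain e where e: "\<And>i. e i > 0" "\<And>i. ball (a i) (e i) \<subseteq> X i" by metis
    define \<epsilon> where "\<epsilon> = Min (insert 1 (e ` {..<n}))"
    have "\<epsilon> > 0" unfolding \<epsilon>_def using e(1) by (subst Min_gr_iff) auto
    moreover have "b \<in> S" if b: "\<forall>i<n. dist (b i) (a i) < \<epsilon>" for b
    proof -
      have "b i \<in> X i" for i
      proof (cases "i < n")
        case True
        then have "\<epsilon> \<le> e i" unfolding \<epsilon>_def by (intro Min_le) auto
        with b True have "b i \<in> ball (a i) (e i)" by (fastforce simp: dist_commute)
        then show ?thesis using e(2)[of i] by blast
      next
        case False
        then show ?thesis using n by blast
      qed
      then show ?thesis using X(4) by auto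
    qed
    ultimately show ?thesis by blast
  qed
  obtain n1 e1 where 1: "e1 > 0" "\<And>b. \<forall>i<n1. dist (b i) ((h \<circ> p) i) < e1 \<Longrightarrow> b \<in> A"
    using nb[OF AB(1,3)] by blast
  obtain n2 e2 where 2: "e2 > 0" "\<And>b. \<forall>i<n2. dist (b i) ((inv h \<circ> p) i) < e2 \<Longrightarrow> b \<in> B"
    using nb[OF AB(2,4)] by blast
  \<comment> \<open>Three errors add up when \<open>g (p n)\<close> is compared with
    \<open>h (p n)\<close>.\<close>
  define \<epsilon> where "\<epsilon> = min e1 e2 / 3"
  have \<epsilon>: "\<epsilon> > 0" "3 * \<epsilon> \<le> e1" "\<epsilon> \<le> e2" using 1(1) 2(1) by (auto simp: \<epsilon>_def)
  have "\<forall>n. \<exists>i. dist (h (p n)) (p i) < \<epsilon>" using p \<epsilon>(1) unfolding dense_seq_def by blast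
  then obtain s where s: "\<And>n. dist (h (p n)) (p (s n)) < \<epsilon>" by metis
  \<comment> \<open>Large enough to exceed every \<open>s n\<close> with \<open>n < n1\<close> as
    well as all indices below \<open>n2\<close>.\<close>
  define m where "m = n2 + Suc (\<Sum>n<n1. s n)"
  show thesis
  proof
    fix g assume g: "g \<in> Iso" "\<forall>i<m. dist (g (inv h (p i))) (p i) < \<epsilon>"
    have "dist ((g \<circ> p) n) ((h \<circ> p) n) < e1" if "n < n1" for n
    proof -
      have "s n < m" unfolding m_def using member_le_sum[of n "{..<n1}" s] that by simp
      then have "dist (g (inv h (p (s n)))) (p (s n)) < \<epsilon>" using g by blast
      moreover have "dist (g (p n)) (g (inv h (p (s n)))) < \<epsilon>"
        using s[of n] g hI by (simp add: Iso_dist Iso_dist_inv)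
      ultimately show ?thesis using s[of n] \<epsilon> by simp metric
    qed
    then have "g \<circ> p \<in> A" by (intro 1(2)) blast
    moreover have "dist ((inv g \<circ> p) n) ((inv h \<circ> p) n) < e2" if "n < n2" for n
    proof -
      have "dist (g (inv h (p n))) (p n) < \<epsilon>" using g that by (simp add: m_def)
      then show ?thesis using g \<epsilon> by (simp add: Iso_dist_inv' dist_commute)
    qed
    then have "inv g \<circ> p \<in> B" by (intro 2(2)) blast
    ultimately show "g \<in> U" using V(2) AB(5) g(1) by (auto simp: Iso_code_def)
  qed (fact \<epsilon>)
qed

subsection \<open>Approximate homogeneity of the Urysohn sphere\<close>

text \<open>Universality speaks only of metrics on sets of reals, so the finite space is transported
  along an injection into the natural numbers. The carrier type is arbitrary because a disjoint sum
  will be embedded.\<close>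

lemma separably_universal_finite:
  fixes S :: "'a set"
  assumes U: "separably_universal TYPE('u::metric_space)"
    and S: "finite S" "Metric_space S d" "\<And>x y. x \<in> S \<Longrightarrow> y \<in> S \<Longrightarrow> d x y \<le> 1"
  shows "\<exists>h :: 'a \<Rightarrow> 'u. \<forall>x\<in>S. \<forall>y\<in>S. dist (h x) (h y) = d x y"
proof -
  interpret S: Metric_space S d by fact
  obtain i :: "'a \<Rightarrow> nat" where "inj_on i S"
    using finite_imp_inj_to_nat_seg[OF S(1)] by blast
  then have i: "inj_on (real \<circ> i) S"
    by (simp add: inj_on_def)
  define i' where "i' = inv_into S (real \<circ> i)"
  define R where "R = (real \<circ> i) ` S"
  have i'_R: "i' y \<in> S" if "y \<in> R" for y
    using that unfolding R_def i'_def by (rule inv_into_into)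
  have i'_eq: "i' (real (i x)) = x" if "x \<in> S" for x
    using inv_into_f_f[OF i that] by (simp add: i'_def)
  have i'_inj: "i' x = i' y \<longleftrightarrow> x = y" if "x \<in> R" "y \<in> R" for x y
    using that by (auto simp: R_def i'_eq)
  interpret R: Metric_space R "\<lambda>x y. d (i' x) (i' y)"
    by unfold_locales (auto simp: i'_R i'_inj S.commute intro: S.triangle)
  have "separable_space R.mtopology"
    unfolding separable_space_def
    using S(1) closure_of_topspace[of R.mtopology] unfolding R.topspace_mtopology
    by (intro exI[of _ R]) (simp add: R_def countable_finite)
  then have "\<exists>h :: real \<Rightarrow> 'u. \<forall>x\<in>R. \<forall>y\<in>R. dist (h x) (h y) = d (i' x) (i' y)"
    using R.Metric_space_axioms S(3)[OF i'_R i'_R]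
    by (intro U[unfolded separably_universal_def, rule_format, of R "\<lambda>x y. d (i' x) (i' y)"]) simp
  then obtain h :: "real \<Rightarrow> 'u" where h: "\<forall>x\<in>R. \<forall>y\<in>R. dist (h x) (h y) = d (i' x) (i' y)"
    by (rule exE)
  have "dist (h (real (i x))) (h (real (i y))) = d x y" if "x \<in> S" "y \<in> S" for x y
    using h that by (simp add: R_def i'_eq)
  then show ?thesis by (intro exI[of _ "\<lambda>x. h (real (i x))"]) auto
qed

lemma ultrahomogeneous_subset:
  fixes F :: "'u::metric_space set"
  assumes "ultrahomogeneous TYPE('u)" "finite F"
    "\<And>x y. x \<in> F \<Longrightarrow> y \<in> F \<Longrightarrow> dist (h x) (h y) = dist x y"
  obtains g where "g \<in> Iso" "\<And>x. x \<in> F \<Longrightarrow> g x = h x"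
  using assms unfolding ultrahomogeneous_def by metis

text \<open>The two finite spaces are glued so that \<open>v i\<close> and \<open>p i\<close> have distance \<open>\<eta>\<close>.\<close>

definition glue_cross :: "real \<Rightarrow> nat \<Rightarrow> (nat \<Rightarrow> 'u::metric_space) \<Rightarrow> (nat \<Rightarrow> 'u) \<Rightarrow> 'u \<Rightarrow> 'u \<Rightarrow> real" where
  "glue_cross \<eta> m v p x y = \<eta> + Min ((\<lambda>i. dist x (v i) + dist (p i) y) ` {..<m})"

fun glue_dist :: "('u::metric_space \<Rightarrow> 'u \<Rightarrow> real) \<Rightarrow> 'u + 'u \<Rightarrow> 'u + 'u \<Rightarrow> real" where
  "glue_dist \<rho> (Inl x) (Inl y) = dist x y"
| "glue_dist \<rho> (Inr x) (Inr y) = dist x y"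
| "glue_dist \<rho> (Inl x) (Inr y) = min 1 (\<rho> x y)"
| "glue_dist \<rho> (Inr y) (Inl x) = min 1 (\<rho> x y)"

lemma glue_cross_le: "i < m \<Longrightarrow> glue_cross \<eta> m v p x y \<le> \<eta> + dist x (v i) + dist (p i) y"
  unfolding glue_cross_def add.assoc by (intro add_left_mono Min_le) auto

lemma glue_cross_attained:
  assumes "0 < m"
  obtains i where "i < m" "glue_cross \<eta> m v p x y = \<eta> + dist x (v i) + dist (p i) y"
proof -
  have "Min ((\<lambda>i. dist x (v i) + dist (p i) y) ` {..<m}) \<in> (\<lambda>i. dist x (v i) + dist (p i) y) ` {..<m}"
    using assms by (intro Min_in) auto
  then obtain i where "i < m"
      "Min ((\<lambda>i. dist x (v i) + dist (p i) y) ` {..<m}) = dist x (v i) + dist (p i) y" by auto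
  then show thesis using that[of i] by (simp add: glue_cross_def)
qed

text \<open>The factor 2 is what the triangle inequality asks for: going from one copy to the other
  and back costs \<eta> twice, which must compensate for the difference between the two metrics.
  Truncation at 1 keeps the diameter admissible and preserves the triangle inequality because the
  original distances are at most 1.\<close>

lemma Metric_space_glue:
  fixes v p :: "nat \<Rightarrow> 'u::metric_space"
  assumes m: "0 < m" and \<eta>: "\<eta> > 0" and bd: "\<And>x y :: 'u. dist x y \<le> 1"
    and near: "\<And>i j. i < m \<Longrightarrow> j < m \<Longrightarrow> \<bar>dist (v i) (v j) - dist (p i) (p j)\<bar> \<le> 2 * \<eta>"
  shows "Metric_space S (glue_dist (glue_cross \<eta> m v p))"
proof -
  define \<rho> where "\<rho> = glue_cross \<eta> m v p"
  have pos: "\<rho> x y > 0" for x y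
    using \<eta> unfolding \<rho>_def by (rule_tac glue_cross_attained[OF m, of \<eta> v p x y]) (simp add: add_pos_nonneg)
  have t1: "\<rho> x z \<le> dist x y + \<rho> y z" for x y z
  proof -
    obtain i where "i < m" "\<rho> y z = \<eta> + dist y (v i) + dist (p i) z"
      unfolding \<rho>_def by (rule glue_cross_attained[OF m])
    then show ?thesis
      using glue_cross_le[of i m \<eta> v p x z] dist_triangle[of x "v i" y] by (simp add: \<rho>_def)
  qed
  have t2: "\<rho> x z \<le> \<rho> x y + dist y z" for x y z
  proof -
    obtain i where "i < m" "\<rho> x y = \<eta> + dist x (v i) + dist (p i) y"
      unfolding \<rho>_def by (rule glue_cross_attained[OF m])
    then show ?thesis
      using glue_cross_le[of i m \<eta> v p x z] dist_triangle[of "p i" z y] by (simp add: \<rho>_def)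
  qed
  have t3: "dist x x' \<le> \<rho> x y + \<rho> x' y" and t4: "dist y y' \<le> \<rho> x y + \<rho> x y'" for x x' y y'
  proof -
    obtain i where i: "i < m" "\<rho> x y = \<eta> + dist x (v i) + dist (p i) y"
      unfolding \<rho>_def by (rule glue_cross_attained[OF m])
    obtain j where j: "j < m" "\<rho> x' y = \<eta> + dist x' (v j) + dist (p j) y"
      unfolding \<rho>_def by (rule glue_cross_attained[OF m])
    obtain k where k: "k < m" "\<rho> x y' = \<eta> + dist x (v k) + dist (p k) y'"
      unfolding \<rho>_def by (rule glue_cross_attained[OF m])
    have "dist (v i) (v j) \<le> dist (p i) (p j) + 2 * \<eta>"
      using near[OF i(1) j(1)] by simp
    moreover have "dist x x' \<le> dist x (v i) + dist (v i) (v j) + dist x' (v j)" by metric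
    moreover have "dist (p i) (p j) \<le> dist (p i) y + dist (p j) y" by metric
    ultimately show "dist x x' \<le> \<rho> x y + \<rho> x' y" using i j by simp
    have "dist (p i) (p k) \<le> dist (v i) (v k) + 2 * \<eta>"
      using near[OF i(1) k(1)] by simp
    moreover have "dist y y' \<le> dist (p i) y + dist (p i) (p k) + dist (p k) y'" by metric
    moreover have "dist (v i) (v k) \<le> dist x (v i) + dist x (v k)" by metric
    ultimately show "dist y y' \<le> \<rho> x y + \<rho> x y'" using i k by simp
  qed
  have T: "min 1 (\<rho> x z) \<le> dist x y + min 1 (\<rho> y z)" "min 1 (\<rho> x z) \<le> min 1 (\<rho> y z) + dist y x"
    "min 1 (\<rho> x z) \<le> min 1 (\<rho> x y) + dist y z" "min 1 (\<rho> x z) \<le> dist z y + min 1 (\<rho> x y)"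
    "dist x y \<le> min 1 (\<rho> x z) + min 1 (\<rho> y z)" "dist x y \<le> min 1 (\<rho> z x) + min 1 (\<rho> z y)" for x y z
    using t1[of x z y] t2[of x z y] t3[of x y z] t4[of x y z] bd[of x y] pos[of x z] pos[of y z]
      pos[of z x] pos[of z y] dist_commute[of y z] dist_commute[of x y] zero_le_dist[of x y] zero_le_dist[of y z]
    by linarith+
  show ?thesis
    unfolding \<rho>_def[symmetric]
  proof
    fix a b c :: "'u + 'u"
    show "0 \<le> glue_dist \<rho> a b"
      using pos by (cases a; cases b) (auto simp: less_imp_le)
    show "glue_dist \<rho> a b = glue_dist \<rho> b a"
      by (cases a; cases b) (auto simp: dist_commute)
    show "glue_dist \<rho> a b = 0 \<longleftrightarrow> a = b"
      by (cases a; cases b) (use pos in \<open>auto simp: min_def\<close>, (metis less_irrefl)+)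
    show "glue_dist \<rho> a c \<le> glue_dist \<rho> a b + glue_dist \<rho> b c"
      by (cases a; cases b; cases c) (simp_all only: glue_dist.simps T dist_triangle)
  qed
qed

text \<open>The glued space is embedded into the sphere. Ultrahomogeneity gives an isometry
  \<open>g1\<close> taking the tuple \<open>v\<close> to its copy and \<open>g2\<close> taking
  \<open>p\<close> to its copy, and corresponding points of the copies are at most \<eta> apart; so
  \<open>inv g2 \<circ> g1\<close> works.\<close>

lemma urysohn_approx_homogeneous:
  fixes v p :: "nat \<Rightarrow> 'u::polish_space"
  assumes U: "urysohn_sphere TYPE('u)" and \<eta>: "\<eta> > 0"
    and near: "\<And>i j. i < m \<Longrightarrow> j < m \<Longrightarrow> \<bar>dist (v i) (v j) - dist (p i) (p j)\<bar> \<le> 2 * \<eta>"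
  shows "\<exists>g\<in>Iso. \<forall>i<m. dist (g (v i)) (p i) \<le> \<eta>"
\<comment> \<open>For \<open>m = 0\<close> the minimum in \<open>glue_cross\<close> would range over
  the empty set.\<close>
proof (cases "m = 0")
  case True
  then show ?thesis using id_in_Iso by auto
next
  case False
  have bd: "dist x y \<le> 1" for x y :: 'u
    using U by (simp add: urysohn_sphere_def)
  have hom: "ultrahomogeneous TYPE('u)"
    using U by (simp add: urysohn_sphere_def)
  let ?V = "v ` {..<m}" and ?P = "p ` {..<m}"
  let ?d = "glue_dist (glue_cross \<eta> m v p)"
  have "\<exists>h :: 'u + 'u \<Rightarrow> 'u. \<forall>x\<in>?V <+> ?P. \<forall>y\<in>?V <+> ?P. dist (h x) (h y) = ?d x y"
  proof (rule separably_universal_finite)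
    show "Metric_space (?V <+> ?P) ?d"
      using False \<eta> bd near by (intro Metric_space_glue) auto
    show "?d a b \<le> 1" for a b
      by (cases a; cases b) (auto simp: bd)
  qed (use U in \<open>auto simp: urysohn_sphere_def\<close>)
  then obtain h :: "'u + 'u \<Rightarrow> 'u"
    where h: "\<And>x y. x \<in> ?V <+> ?P \<Longrightarrow> y \<in> ?V <+> ?P \<Longrightarrow> dist (h x) (h y) = ?d x y"
    by blast
  have hV: "dist (h (Inl x)) (h (Inl y)) = dist x y" if "x \<in> ?V" "y \<in> ?V" for x y
    using h[of "Inl x" "Inl y"] that by (auto simp: Plus_def)
  have hP: "dist (h (Inr x)) (h (Inr y)) = dist x y" if "x \<in> ?P" "y \<in> ?P" for x y
    using h[of "Inr x" "Inr y"] that by (auto simp: Plus_def)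
  obtain g1 where g1: "g1 \<in> Iso" "\<And>x. x \<in> ?V \<Longrightarrow> g1 x = h (Inl x)"
    by (rule ultrahomogeneous_subset[OF hom, of ?V "h \<circ> Inl"]) (simp_all only: o_apply hV finite_imageI finite_lessThan)
  obtain g2 where g2: "g2 \<in> Iso" "\<And>x. x \<in> ?P \<Longrightarrow> g2 x = h (Inr x)"
    by (rule ultrahomogeneous_subset[OF hom, of ?P "h \<circ> Inr"]) (simp_all only: o_apply hP finite_imageI finite_lessThan)
  show ?thesis
  proof (intro bexI[of _ "inv g2 \<circ> g1"] allI impI)
    show "inv g2 \<circ> g1 \<in> Iso" using g1 g2 by (intro comp_in_Iso inv_in_Iso)
    fix i assume i: "i < m"
    have "dist ((inv g2 \<circ> g1) (v i)) (p i) = dist (g1 (v i)) (g2 (p i))"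
      using g2(1) by (simp add: Iso_dist_inv')
    also have "\<dots> = ?d (Inl (v i)) (Inr (p i))"
      using i by (simp add: g1 g2 h Plus_def)
    also have "\<dots> \<le> \<eta>"
      using glue_cross_le[OF i, of \<eta> v p "v i" "p i"] by simp
    finally show "dist ((inv g2 \<circ> g1) (v i)) (p i) \<le> \<eta>" .
  qed
qed

subsection \<open>Formulas\<close>

lemma tm_mod_cong: "(\<And>x. x \<in> tm_fv t \<Longrightarrow> D x = D' x) \<Longrightarrow> tm_mod L D t = tm_mod L D' t"
proof (induction t)
  case (App f ts)
  then have "map (tm_mod L D) ts = map (tm_mod L D') ts" by (intro map_cong) auto
  then show ?case by (simp only: tm_mod.simps)
qed simp

lemma fm_mod_cong: "(\<And>x. x \<in> fv p \<Longrightarrow> D x = D' x) \<Longrightarrow> fm_mod L p D = fm_mod L p D'"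
proof (induction p arbitrary: D D')
  case (Dist s t)
  then show ?case using tm_mod_cong[of s D D' L] tm_mod_cong[of t D D' L] by simp
next
  case (Rel r ts)
  then have "map (tm_mod L D) ts = map (tm_mod L D') ts"
    by (intro map_cong refl tm_mod_cong) auto
  then show ?case by (simp only: fm_mod.simps)
next
  case (Conn h ps)
  have "map (\<lambda>p. fm_mod L p D) ps = map (\<lambda>p. fm_mod L p D') ps"
    by (intro map_cong refl Conn.IH Conn.prems) auto
  then show ?case by (simp only: fm_mod.simps)
next
  case (SupV x p)
  show ?case unfolding fm_mod.simps by (rule SupV.IH) (use SupV.prems in auto)
next
  case (InfV x p)
  show ?case unfolding fm_mod.simps by (rule InfV.IH) (use InfV.prems in auto)
next
  case (SupN ps)
  have "fm_mod L (ps n) D = fm_mod L (ps n) D'" for n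
    by (rule SupN.IH[OF rangeI]) (use SupN.prems in auto)
  then show ?case by simp
next
  case (InfN ps)
  have "fm_mod L (ps n) D = fm_mod L (ps n) D'" for n
    by (rule InfN.IH[OF rangeI]) (use InfN.prems in auto)
  then show ?case by simp
qed

lemma conn_mod_bounds:
  assumes "\<And>d. d \<in> set ds \<Longrightarrow> 0 \<le> d"
    and "\<And>x y. (\<And>i. i < length ds \<Longrightarrow> \<bar>x i - y i\<bar> \<le> ds ! i) \<Longrightarrow> \<bar>h x - h y\<bar> \<le> B"
  shows "0 \<le> conn_mod h ds \<and> conn_mod h ds \<le> B"
proof -
  let ?S = "{\<bar>h x - h y\<bar> | x y. x \<in> tuples (length ds) {0..1} \<and> y \<in> tuples (length ds) {0..1}
     \<and> (\<forall>i<length ds. \<bar>x i - y i\<bar> \<le> ds ! i)}"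
  have B: "s \<le> B" if "s \<in> ?S" for s
    using that by (elim CollectE exE conjE) (simp add: assms(2))
  \<comment> \<open>The pair of two equal points puts 0 into the set, so that its supremum is
    meaningful and nonnegative.\<close>
  let ?z = "\<lambda>i\<in>{..<length ds}. 0 :: real"
  have "\<bar>h ?z - h ?z\<bar> \<in> ?S"
    using assms(1) by (intro CollectI exI[of _ ?z] conjI refl) auto
  then have 0: "0 \<in> ?S" by simp
  have "0 \<le> Sup ?S" by (rule cSup_upper[OF 0]) (use B in \<open>auto simp: bdd_above_def\<close>)
  moreover have "Sup ?S \<le> B" using 0 by (intro cSup_least B) auto
  ultimately show ?thesis unfolding conn_mod_def by blast
qed

text \<open>An entry \<open>(c, a, \<phi>)\<close> contributes
  \<open>c * \<bar>\<phi> - a\<bar>\<close>. This shape covers \<open>1 - \<phi>\<close> (with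
  \<open>a = 1\<close>), the discrepancy of a distance from a prescribed value, and, with negative
  \<open>a\<close>, increasing affine functions.\<close>

definition wconn :: "(real \<times> real \<times> 'b) list \<Rightarrow> (nat \<Rightarrow> real) \<Rightarrow> real" where
  "wconn qs z = min 1 (\<Sum>i<length qs. fst (qs ! i) * \<bar>z i - fst (snd (qs ! i))\<bar>)"

definition wsum :: "(real \<times> real \<times> ('f, 'r) fm) list \<Rightarrow> ('f, 'r) fm" where
  "wsum qs = Conn (wconn qs) (map (\<lambda>q. snd (snd q)) qs)"

lemma fm_val_wsum:
  "fm_val M (wsum qs) e = min 1 (\<Sum>(c, a, \<phi>)\<leftarrow>qs. c * \<bar>fm_val M \<phi> e - a\<bar>)"
proof -
  have "(\<Sum>(c, a, \<phi>)\<leftarrow>qs. c * \<bar>fm_val M \<phi> e - a\<bar>) =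
      (\<Sum>i<length qs. fst (qs ! i) * \<bar>fm_val M (snd (snd (qs ! i))) e - fst (snd (qs ! i))\<bar>)"
    by (simp add: sum_list_sum_nth atLeast0LessThan case_prod_beta)
  then show ?thesis by (simp add: wsum_def wconn_def tuple_def)
qed

lemma fm_val_wsum_nonneg:
  assumes "\<And>q. q \<in> set qs \<Longrightarrow> 0 \<le> fst q"
  shows "0 \<le> fm_val M (wsum qs) e"
  using assms unfolding fm_val_wsum by (auto intro!: sum_list_nonneg)

lemma fm_val_wsum_le_1: "fm_val M (wsum qs) e \<le> 1"
  by (simp add: fm_val_wsum)

lemma fv_wsum: "fv (wsum qs) = (\<Union>q\<in>set qs. fv (snd (snd q)))"
  by (simp add: wsum_def)

lemma formula_wsum:
  assumes "\<And>q. q \<in> set qs \<Longrightarrow> 0 \<le> fst q" "\<And>q. q \<in> set qs \<Longrightarrow> formula L (snd (snd q))"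
  shows "formula L (wsum qs)"
  unfolding wsum_def
proof (rule formula.intros)
  have "continuous_on S (wconn qs)" for S
    unfolding wconn_def
    by (intro continuous_intros continuous_on_subset[OF continuous_on_product_coordinates]) auto
  moreover have "0 \<le> wconn qs z" "wconn qs z \<le> 1" for z
    using assms(1)[OF nth_mem] by (auto simp: wconn_def intro!: sum_nonneg mult_nonneg_nonneg)
  ultimately show "connective (length (map (\<lambda>q. snd (snd q)) qs)) (wconn qs)"
    unfolding connective_def by auto
qed (use assms(2) in auto)

text \<open>Each summand is \<open>c\<close>-Lipschitz in its argument and truncation at 1 does not
  increase differences, so the computed moduli add up with the weights as coefficients.\<close>

lemma fm_mod_wsum:
  assumes "\<And>q. q \<in> set qs \<Longrightarrow> 0 \<le> fst q" "\<And>q. q \<in> set qs \<Longrightarrow> 0 \<le> fm_mod L (snd (snd q)) D"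
  shows "0 \<le> fm_mod L (wsum qs) D \<and> fm_mod L (wsum qs) D \<le> (\<Sum>(c, a, \<phi>)\<leftarrow>qs. c * fm_mod L \<phi> D)"
  unfolding wsum_def fm_mod.simps
proof (rule conn_mod_bounds)
  fix x y :: "nat \<Rightarrow> real"
  let ?ds = "map (\<lambda>p. fm_mod L p D) (map (\<lambda>q. snd (snd q)) qs)"
  assume xy: "\<And>i. i < length ?ds \<Longrightarrow> \<bar>x i - y i\<bar> \<le> ?ds ! i"
  let ?f = "\<lambda>x i. fst (qs ! i) * \<bar>x i - fst (snd (qs ! i))\<bar>"
  have "\<bar>wconn qs x - wconn qs y\<bar> \<le> \<bar>(\<Sum>i<length qs. ?f x i) - (\<Sum>i<length qs. ?f y i)\<bar>"
    unfolding wconn_def by linarith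
  also have "\<dots> \<le> (\<Sum>i<length qs. \<bar>?f x i - ?f y i\<bar>)"
    unfolding sum_subtractf[symmetric] by (rule sum_abs)
  also have "\<dots> \<le> (\<Sum>i<length qs. fst (qs ! i) * fm_mod L (snd (snd (qs ! i))) D)"
  proof (rule sum_mono)
    fix i assume "i \<in> {..<length qs}"
    then have i: "i < length qs" by simp
    then have c: "0 \<le> fst (qs ! i)" using assms(1) nth_mem by blast
    have "\<bar>?f x i - ?f y i\<bar> = fst (qs ! i) * \<bar>\<bar>x i - fst (snd (qs ! i))\<bar> - \<bar>y i - fst (snd (qs ! i))\<bar>\<bar>"
      using c by (simp add: right_diff_distrib[symmetric] abs_mult)
    also have "\<dots> \<le> fst (qs ! i) * fm_mod L (snd (snd (qs ! i))) D"
      using xy[of i] i by (intro mult_left_mono c) simp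
    finally show "\<bar>?f x i - ?f y i\<bar> \<le> fst (qs ! i) * fm_mod L (snd (snd (qs ! i))) D" .
  qed
  also have "\<dots> = (\<Sum>(c, a, \<phi>)\<leftarrow>qs. c * fm_mod L \<phi> D)"
    by (simp add: sum_list_sum_nth atLeast0LessThan case_prod_beta)
  finally show "\<bar>wconn qs x - wconn qs y\<bar> \<le> (\<Sum>(c, a, \<phi>)\<leftarrow>qs. c * fm_mod L \<phi> D)" .
qed (use assms(2) in auto)

section \<open>Blocks of infimum quantifiers and countable infima\<close>

definition infvs :: "nat list \<Rightarrow> ('f, 'r) fm \<Rightarrow> ('f, 'r) fm" where
  "infvs xs p = foldr InfV xs p"

lemma fv_infvs: "fv (infvs xs p) = fv p - set xs"
  by (induction xs) (auto simp: infvs_def)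

lemma formula_infvs: "formula L p \<Longrightarrow> formula L (infvs xs p)"
  by (induction xs) (auto simp: infvs_def intro: formula.intros)

text \<open>Quantified variables enter the computed modulus at distance 0. This is what keeps the
  large constants of inner formulas out of the final modulus.\<close>

lemma fm_mod_infvs: "fm_mod L (infvs xs p) D = fm_mod L p (\<lambda>x. if x \<in> set xs then 0 else D x)"
proof (induction xs arbitrary: D)
  case (Cons y xs)
  have "fm_mod L (infvs (y # xs) p) D = fm_mod L (infvs xs p) (D(y := 0))"
    by (simp add: infvs_def)
  then show ?case unfolding Cons.IH by (auto intro!: arg_cong[of _ _ "fm_mod L p"])
qed (simp add: infvs_def)

text \<open>A strict upper bound on an infimum is witnessed by a single assignment, so the whole
  block acts like one existential quantifier over the variables in \<open>xs\<close>. Nonnegativity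
  is carried along because each real infimum needs a lower bound.\<close>

lemma infvs_bounds_less:
  assumes "\<And>e. 0 \<le> fm_val M p e"
  shows "0 \<le> fm_val M (infvs xs p) e \<and>
    (fm_val M (infvs xs p) e < r \<longleftrightarrow> (\<exists>e'. (\<forall>x. x \<notin> set xs \<longrightarrow> e' x = e x) \<and> fm_val M p e' < r))"
proof (induction xs arbitrary: e)
  case Nil
  have "(\<forall>x. e' x = e x) \<longleftrightarrow> e' = e" for e' by auto
  then show ?case using assms by (simp add: infvs_def)
next
  case (Cons y xs)
  let ?f = "\<lambda>a. fm_val M (infvs xs p) (e(y := a))"
  have val: "fm_val M (infvs (y # xs) p) e = (INF a. ?f a)"
    by (simp add: infvs_def)
  have 0: "0 \<le> ?f a" for a using Cons.IH by blast
  then have "bdd_below (range ?f)" by (auto simp: bdd_below_def)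
  then have "(INF a. ?f a) < r \<longleftrightarrow> (\<exists>a. ?f a < r)"
    by (subst cINF_less_iff) auto
  also have "\<dots> \<longleftrightarrow> (\<exists>a e'. (\<forall>x. x \<notin> set xs \<longrightarrow> e' x = (e(y := a)) x) \<and> fm_val M p e' < r)"
    using Cons.IH by blast
  also have "\<dots> \<longleftrightarrow> (\<exists>e'. (\<forall>x. x \<notin> set (y # xs) \<longrightarrow> e' x = e x) \<and> fm_val M p e' < r)"
    (is "?l = ?r")
  proof
    assume ?r
    then obtain e' where e': "\<forall>x. x \<notin> set (y # xs) \<longrightarrow> e' x = e x" "fm_val M p e' < r" by blast
    then show ?l by (intro exI[of _ "e' y"] exI[of _ e']) auto
  next
    assume ?l
    then obtain a e' where e': "\<forall>x. x \<notin> set xs \<longrightarrow> e' x = (e(y := a)) x" "fm_val M p e' < r"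
      by blast
    then show ?r by (intro exI[of _ e']) auto
  qed
  finally show ?case using 0 unfolding val by (auto intro!: cINF_greatest)
qed

lemma fm_val_infvs_le:
  assumes "\<And>e. 0 \<le> fm_val M p e"
  shows "fm_val M (infvs xs p) e \<le> fm_val M p e"
  using infvs_bounds_less[OF assms, of xs e "fm_val M (infvs xs p) e"] by force

lemma fm_val_InfN_less:
  assumes "\<And>n. 0 \<le> fm_val M (ps n) e"
  shows "fm_val M (InfN ps) e < r \<longleftrightarrow> (\<exists>n. fm_val M (ps n) e < r)"
proof -
  have "bdd_below (range (\<lambda>n. fm_val M (ps n) e))" using assms by (auto simp: bdd_below_def)
  then show ?thesis by (simp add: cINF_less_iff)
qed

lemma fm_val_InfN_bounds:
  assumes "\<And>n. 0 \<le> fm_val M (ps n) e" "\<And>n. fm_val M (ps n) e \<le> 1"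
  shows "0 \<le> fm_val M (InfN ps) e" "fm_val M (InfN ps) e \<le> 1"
proof -
  show "0 \<le> fm_val M (InfN ps) e" using assms(1) by (auto intro: cINF_greatest)
  have "bdd_below (range (\<lambda>n. fm_val M (ps n) e))" using assms(1) by (auto simp: bdd_below_def)
  then show "fm_val M (InfN ps) e \<le> 1" using assms(2)[of 0] by (auto intro: cINF_lower2)
qed

text \<open>One linear modulus witnesses the side condition on countable infima and passes to the
  infimum, so the construction can be repeated.\<close>

lemma formula_InfN_linear:
  assumes "\<And>n. formula L (ps n)" "\<And>n. fv (ps n) \<subseteq> F" "finite F" "0 \<le> C"
    and "\<And>n t. 0 \<le> t \<Longrightarrow> 0 \<le> fm_mod L (ps n) (\<lambda>_. t) \<and> fm_mod L (ps n) (\<lambda>_. t) \<le> C * t"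
  shows "formula L (InfN ps)" "fv (InfN ps) \<subseteq> F"
    "0 \<le> t \<Longrightarrow> 0 \<le> fm_mod L (InfN ps) (\<lambda>_. t) \<and> fm_mod L (InfN ps) (\<lambda>_. t) \<le> C * t"
proof -
  have F: "(\<Union>n. fv (ps n)) \<subseteq> F" using assms(2) by blast
  then show "fv (InfN ps) \<subseteq> F" by simp
  have "modulus (\<lambda>t. C * t)" using assms(4) by (auto simp: modulus_def intro!: continuous_intros)
  then show "formula L (InfN ps)"
    using assms F unfolding uniformly_bounded_moduli_def
    by (intro formula.intros) (auto intro: finite_subset simp: uniformly_bounded_moduli_def)
  assume t: "0 \<le> t"
  have "bdd_above (range (\<lambda>n. fm_mod L (ps n) (\<lambda>_. t)))"
    using assms(5)[OF t] by (auto simp: bdd_above_def)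
  then show "0 \<le> fm_mod L (InfN ps) (\<lambda>_. t) \<and> fm_mod L (InfN ps) (\<lambda>_. t) \<le> C * t"
    using assms(5)[OF t] by (auto intro: cSUP_least cSUP_upper2)
qed

subsection \<open>Vaught transforms\<close>

lemma openin_Iso_top_balls:
  assumes p: "dense_seq p"
  shows "openin (Iso_top p) {g \<in> Iso. \<forall>i<m::nat. dist (g (a i)) (c i) < \<eta>}"
proof (induction m)
  case 0
  then show ?case using openin_topspace[of "Iso_top p"] by simp
next
  case (Suc m)
  have "{g \<in> Iso. \<forall>i<Suc m. dist (g (a i)) (c i) < \<eta>} =
      {g \<in> Iso. \<forall>i<m. dist (g (a i)) (c i) < \<eta>} \<inter> {g \<in> Iso. dist (g (a m)) (c m) < \<eta>}"
    by (auto simp: less_Suc_eq)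
  then show ?case using Suc openin_Iso_top_ball[OF p, of "a m" "c m" \<eta>] by auto
qed

lemma openin_Iso_top_sum:
  assumes p: "dense_seq p"
  shows "openin (Iso_top p) {g \<in> Iso. real N * (\<Sum>i<(k::nat). dist (g (a i)) (c i)) < r}" (is "openin _ ?O")
proof (subst openin_subopen, rule ballI)
  fix g0 assume g0: "g0 \<in> ?O"
  \<comment> \<open>A displacement of \<open>s\<close> at each of the \<open>k\<close> points
    changes the weighted sum by at most \<open>N * k * s\<close>, which is below the available
    slack; the \<open>+ 1\<close> covers \<open>N * k = 0\<close>.\<close>
  define s where "s = (r - real N * (\<Sum>i<k. dist (g0 (a i)) (c i))) / (real N * real k + 1)"
  have s: "s > 0" using g0 unfolding s_def by (intro divide_pos_pos) (auto intro: add_nonneg_pos)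
  let ?W = "{g \<in> Iso. \<forall>i<k. dist (g (a i)) (g0 (a i)) < s}"
  have "g \<in> ?O" if g: "g \<in> ?W" for g
  proof -
    have "(\<Sum>i<k. dist (g (a i)) (c i)) \<le> (\<Sum>i<k. dist (g0 (a i)) (c i) + s)"
      using g by (intro sum_mono) (smt (verit) dist_triangle lessThan_iff mem_Collect_eq)
    also have "\<dots> = (\<Sum>i<k. dist (g0 (a i)) (c i)) + real k * s"
      by (simp add: sum.distrib)
    finally have "real N * (\<Sum>i<k. dist (g (a i)) (c i)) \<le>
        real N * (\<Sum>i<k. dist (g0 (a i)) (c i)) + real N * real k * s"
      by (metis distrib_left mult.assoc mult_left_mono of_nat_0_le_iff)
    also have "\<dots> < r"
    proof -
      have "(real N * real k + 1) * s = r - real N * (\<Sum>i<k. dist (g0 (a i)) (c i))"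
        unfolding s_def by (simp add: add_nonneg_eq_0_iff)
      then show ?thesis using s by (simp add: algebra_simps)
    qed
    finally show ?thesis using g by simp
  qed
  moreover have "g0 \<in> ?W" using g0 s by simp
  ultimately show "\<exists>T. openin (Iso_top p) T \<and> g0 \<in> T \<and> T \<subseteq> ?O"
    using openin_Iso_top_balls[OF p, of k a "\<lambda>i. g0 (a i)" s] by blast
qed

text \<open>Here \<open>\<phi>\<close> evaluates the truncated essential infimum of \<open>N * (\<Sum>i<k. d (g u\<^sub>i) p\<^sub>i)\<close> over the
  \<open>g\<close> with \<open>gM \<in> B\<close>; it is described by its strict sublevel sets. The name \<open>x i\<close> of the variable
  holding \<open>u\<^sub>i\<close> is a parameter, so that no substitution into formulas is ever needed.\<close>

definition vaught_formula ::
    "('f, 'r) lang \<Rightarrow> (nat \<Rightarrow> 'u::metric_space) \<Rightarrow> ('f, 'r, 'u) struct set \<Rightarrow> nat \<Rightarrow> nat \<Rightarrow>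
     (nat \<Rightarrow> nat) \<Rightarrow> ('f, 'r) fm \<Rightarrow> bool" where
  "vaught_formula L p B N k x \<phi> \<longleftrightarrow> formula L \<phi> \<and> fv \<phi> \<subseteq> x ` {..<k} \<and>
     (\<forall>t\<ge>0. 0 \<le> fm_mod L \<phi> (\<lambda>_. t) \<and> fm_mod L \<phi> (\<lambda>_. t) \<le> real N * real k * t) \<and>
     (\<forall>M\<in>Mod L. \<forall>e. 0 \<le> fm_val M \<phi> e \<and> fm_val M \<phi> e \<le> 1 \<and>
       (\<forall>r. 0 < r \<longrightarrow> r \<le> 1 \<longrightarrow> (fm_val M \<phi> e < r \<longleftrightarrow>
         \<not> meager (Iso_top p)
            {g \<in> Iso. act L g M \<in> B \<and> real N * (\<Sum>i<k. dist (g (e (x i))) (p i)) < r})))"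

lemma vaught_formula_InfN:
  fixes L :: "('f, 'r) lang" and p :: "nat \<Rightarrow> 'u::metric_space"
  assumes "\<And>n. formula L (ps n)" "\<And>n. fv (ps n) \<subseteq> x ` {..<k}"
    and "\<And>n t. 0 \<le> t \<Longrightarrow>
      0 \<le> fm_mod L (ps n) (\<lambda>_. t) \<and> fm_mod L (ps n) (\<lambda>_. t) \<le> real N * real k * t"
    and "\<And>n (M :: ('f, 'r, 'u) struct) e. M \<in> Mod L \<Longrightarrow> 0 \<le> fm_val M (ps n) e"
    and "\<And>n (M :: ('f, 'r, 'u) struct) e. M \<in> Mod L \<Longrightarrow> fm_val M (ps n) e \<le> 1"
    and "\<And>(M :: ('f, 'r, 'u) struct) e r. M \<in> Mod L \<Longrightarrow> 0 < r \<Longrightarrow> r \<le> 1 \<Longrightarrow>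
      fm_val M (InfN ps) e < r \<longleftrightarrow> \<not> meager (Iso_top p) {g \<in> Iso. act L g M \<in> B \<and>
        real N * (\<Sum>i<k. dist (g (e (x i))) (p i)) < r}"
  shows "vaught_formula L p B N k x (InfN ps)"
proof -
  have "finite (x ` {..<k})" "0 \<le> real N * real k" by auto
  note lin = formula_InfN_linear[of L ps, OF assms(1,2) this assms(3)]
  show ?thesis
    unfolding vaught_formula_def
  proof (intro conjI ballI allI impI)
    fix M :: "('f, 'r, 'u) struct" and e assume M: "M \<in> Mod L"
    show "0 \<le> fm_val M (InfN ps) e" "fm_val M (InfN ps) e \<le> 1"
      by (intro fm_val_InfN_bounds assms M)+
  qed (use lin assms(6) in blast)+
qed

text \<open>All \<open>N\<close>, \<open>k\<close> and \<open>x\<close> are required at once: the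
  complement step at given parameters uses transforms with larger constants, longer tuples and other
  variables.\<close>

definition vaught_definable ::
    "('f, 'r) lang \<Rightarrow> (nat \<Rightarrow> 'u::metric_space) \<Rightarrow> ('f, 'r, 'u) struct set \<Rightarrow> bool" where
  "vaught_definable L p B \<longleftrightarrow> (\<forall>N k x. \<exists>\<phi>. vaught_formula L p B N k x \<phi>)"

text \<open>The essential infimum over a countable union is the infimum of the essential infima, and
  the linear bound on the moduli does not depend on the member.\<close>

lemma vaught_definable_UN:
  fixes L :: "('f, 'r) lang" and p :: "nat \<Rightarrow> 'u::metric_space"
  assumes "\<And>n::nat. vaught_definable L p (B n)"
  shows "vaught_definable L p (\<Union>n. B n)"
  unfolding vaught_definable_def
proof (intro allI)
  fix N k x
  have "\<forall>n. \<exists>\<phi>. vaught_formula L p (B n) N k x \<phi>"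
    using assms unfolding vaught_definable_def by blast
  then obtain \<phi> where \<phi>: "\<And>n. vaught_formula L p (B n) N k x (\<phi> n)" by metis
  have val: "0 \<le> fm_val M (\<phi> n) e" "fm_val M (\<phi> n) e \<le> 1"
    if "M \<in> Mod L" for M :: "('f, 'r, 'u) struct" and n e using \<phi>[of n] that by (simp_all add: vaught_formula_def)
  have md: "0 \<le> t \<Longrightarrow> 0 \<le> fm_mod L (\<phi> n) (\<lambda>_. t) \<and> fm_mod L (\<phi> n) (\<lambda>_. t) \<le> (real N * real k) * t"
    for t n using \<phi>[of n] by (simp add: vaught_formula_def)
  have fm: "formula L (\<phi> n)" "fv (\<phi> n) \<subseteq> x ` {..<k}" for n
    using \<phi>[of n] by (simp_all add: vaught_formula_def)
  have less: "fm_val M (InfN \<phi>) e < r \<longleftrightarrow> \<not> meager (Iso_top p) {g \<in> Iso. act L g M \<in> (\<Union>n. B n) \<and>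
      real N * (\<Sum>i<k. dist (g (e (x i))) (p i)) < r}"
    if "M \<in> Mod L" "0 < r" "r \<le> 1" for M :: "('f, 'r, 'u) struct" and e r
  proof -
    let ?S = "\<lambda>n. {g \<in> Iso. act L g M \<in> B n \<and> real N * (\<Sum>i<k. dist (g (e (x i))) (p i)) < r}"
    have "fm_val M (InfN \<phi>) e < r \<longleftrightarrow> (\<exists>n. fm_val M (\<phi> n) e < r)"
      using val that by (intro fm_val_InfN_less) auto
    also have "\<dots> \<longleftrightarrow> (\<exists>n. \<not> meager (Iso_top p) (?S n))"
      using \<phi> that unfolding vaught_formula_def by simp
    also have "\<dots> \<longleftrightarrow> \<not> meager (Iso_top p) (\<Union>n. ?S n)"
      using meager_UN[of "Iso_top p" ?S] meager_subset[of "Iso_top p" "\<Union>n. ?S n"] by blast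
    also have "(\<Union>n. ?S n) = {g \<in> Iso. act L g M \<in> (\<Union>n. B n) \<and>
      real N * (\<Sum>i<k. dist (g (e (x i))) (p i)) < r}" by auto
    finally show ?thesis .
  qed
  have "vaught_formula L p (\<Union>n. B n) N k x (InfN \<phi>)"
    by (rule vaught_formula_InfN[OF fm md val less])
  then show "\<exists>\<phi>. vaught_formula L p (\<Union>n. B n) N k x \<phi>" ..
qed

text \<open>A sum instead of a maximum, so that \<open>wsum\<close> can express it.\<close>

definition discrepancy :: "(nat \<Rightarrow> 'u::metric_space) \<Rightarrow> nat \<Rightarrow> (nat \<Rightarrow> 'u) \<Rightarrow> real" where
  "discrepancy p m v = (\<Sum>i<m. \<Sum>l<m. \<bar>dist (v i) (v l) - dist (p i) (p l)\<bar>)"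

lemma discrepancy_nonneg: "0 \<le> discrepancy p m v"
  by (simp add: discrepancy_def sum_nonneg)

lemma discrepancy_ge:
  assumes "i < m" "l < m"
  shows "\<bar>dist (v i) (v l) - dist (p i) (p l)\<bar> \<le> discrepancy p m v"
proof -
  have "\<bar>dist (v i) (v l) - dist (p i) (p l)\<bar> \<le> (\<Sum>l<m. \<bar>dist (v i) (v l) - dist (p i) (p l)\<bar>)"
    using assms by (intro member_le_sum) auto
  also have "\<dots> \<le> discrepancy p m v"
    unfolding discrepancy_def using assms by (intro member_le_sum) (auto intro: sum_nonneg)
  finally show ?thesis .
qed

lemma not_meager_near:
  fixes p :: "nat \<Rightarrow> 'u::polish_space"
  assumes p: "dense_seq p" and U: "urysohn_sphere TYPE('u)" and \<eta>: "discrepancy p m v < \<eta>"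
  shows "\<not> meager (Iso_top p) {g \<in> Iso. \<forall>i<m. dist (g (v i)) (p i) < \<eta>}"
proof (rule open_not_meager[OF completely_metrizable_Iso_top[OF p] openin_Iso_top_balls[OF p]])
  \<comment> \<open>The midpoint is positive even for discrepancy 0 and lies strictly below \<eta>,
    turning the weak inequality of approximate homogeneity into a strict one.\<close>
  let ?\<eta> = "(discrepancy p m v + \<eta>) / 2"
  have "?\<eta> > 0" using \<eta> discrepancy_nonneg[of p m v] by simp
  moreover have "\<bar>dist (v i) (v j) - dist (p i) (p j)\<bar> \<le> 2 * ?\<eta>" if "i < m" "j < m" for i j
    using discrepancy_ge[OF that, of v p] \<eta> discrepancy_nonneg[of p m v] by simp
  ultimately obtain g where "g \<in> Iso" "\<forall>i<m. dist (g (v i)) (p i) \<le> ?\<eta>"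
    using urysohn_approx_homogeneous[OF U, of ?\<eta> m v p] by blast
  then have "g \<in> {g \<in> Iso. \<forall>i<m. dist (g (v i)) (p i) < \<eta>}" using \<eta> by fastforce
  then show "{g \<in> Iso. \<forall>i<m. dist (g (v i)) (p i) < \<eta>} \<noteq> {}" by blast
qed

lemma sum_list_product:
  "(\<Sum>(i, l)\<leftarrow>List.product [0..<m] [0..<n]. f i l) = (\<Sum>i<m. \<Sum>l<n. f i l :: real)"
  by (simp add: sum_list_distinct_conv_sum_set distinct_product sum.cartesian_product atLeast0LessThan)

text \<open>The witness is the infimum over \<open>j\<close> and over \<open>v\<^sub>0, \<dots>, v\<^sub>m\<^sub>-\<^sub>1\<close> of
  \<open>min 1 (N * (\<Sum>i<k. d u\<^sub>i v\<^sub>i) + (C + N * k) * discrepancy + (1 - \<psi>\<^sub>j(v)))\<close>. The free variables occur in the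
  first summand only and \<open>\<psi>\<^sub>j\<close> has bound variables only, so the computed modulus does not depend
  on \<open>j\<close>.\<close>

lemma approximation_vaught_formula:
  fixes L :: "('f, 'r) lang" and p :: "nat \<Rightarrow> 'u::polish_space" and \<psi> :: "nat \<Rightarrow> ('f, 'r) fm"
  assumes p: "dense_seq p"
    and x: "\<And>i. i < k \<Longrightarrow> x i < b"
    and m: "\<And>j. k \<le> m j" and C: "\<And>j. 0 \<le> C j"
    and \<psi>: "\<And>j. formula L (\<psi> j)" "\<And>j. fv (\<psi> j) \<subseteq> {b..<b + m j}" "\<And>j. fm_mod L (\<psi> j) (\<lambda>_. 0) = 0"
      "\<And>j (M :: ('f, 'r, 'u) struct) e. M \<in> Mod L \<Longrightarrow> fm_val M (\<psi> j) e \<le> 1"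
    and sound: "\<And>j (M :: ('f, 'r, 'u) struct) e \<eta>. M \<in> Mod L \<Longrightarrow>
      C j * discrepancy p (m j) (\<lambda>i. e (b + i)) < fm_val M (\<psi> j) e \<Longrightarrow>
      discrepancy p (m j) (\<lambda>i. e (b + i)) < \<eta> \<Longrightarrow>
      \<not> meager (Iso_top p) {g \<in> Iso. act L g M \<in> B \<and> (\<forall>i<m j. dist (g (e (b + i))) (p i) < \<eta>)}"
    and complete: "\<And>(M :: ('f, 'r, 'u) struct) S. M \<in> Mod L \<Longrightarrow> openin (Iso_top p) S \<Longrightarrow>
      \<not> meager (Iso_top p) {g \<in> S. act L g M \<in> B} \<Longrightarrow>
      \<exists>j. \<exists>g\<in>S. \<forall>e. (\<forall>i<m j. e (b + i) = inv g (p i)) \<longrightarrow> fm_val M (\<psi> j) e = 1"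
  shows "\<exists>\<phi>. vaught_formula L p B N k x \<phi>"
proof -
  define qs where "qs j = [(1, 1, \<psi> j)] @
      map (\<lambda>i. (real N, 0, Dist (Var (x i)) (Var (b + i)))) [0..<k] @
      map (\<lambda>(i, l). (C j + real N * real k, dist (p i) (p l), Dist (Var (b + i)) (Var (b + l))))
        (List.product [0..<m j] [0..<m j])" for j
  define \<phi> where "\<phi> j = infvs [b..<b + m j] (wsum (qs j))" for j
  let ?\<delta> = "\<lambda>j e. discrepancy p (m j) (\<lambda>i. e (b + i))"
  let ?T = "\<lambda>M j e. \<bar>fm_val M (\<psi> j) e - 1\<bar> + real N * (\<Sum>i<k. dist (e (x i)) (e (b + i)))
      + (C j + real N * real k) * ?\<delta> j e"
  have pos: "0 \<le> fst q" if "q \<in> set (qs j)" for q j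
    using that C[of j] by (auto simp: qs_def)
  have fml: "formula L (snd (snd q))" if "q \<in> set (qs j)" for q j
    using that \<psi>(1)[of j] by (auto simp: qs_def intro!: formula.intros is_term.intros)
  have val: "fm_val M (wsum (qs j)) e = min 1 (?T M j e)" for M j e
  proof -
    have "(\<Sum>(c, a, \<phi>)\<leftarrow>qs j. c * \<bar>fm_val M \<phi> e - a\<bar>) = \<bar>fm_val M (\<psi> j) e - 1\<bar> +
       (\<Sum>i\<leftarrow>[0..<k]. real N * dist (e (x i)) (e (b + i))) +
       (\<Sum>(i, l)\<leftarrow>List.product [0..<m j] [0..<m j].
          (C j + real N * real k) * \<bar>dist (e (b + i)) (e (b + l)) - dist (p i) (p l)\<bar>)"
      by (simp add: qs_def o_def case_prod_beta')
    also have "\<dots> = ?T M j e"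
      unfolding sum_list_product discrepancy_def sum_distrib_left
      by (simp add: interv_sum_list_conv_sum_set_nat atLeast0LessThan)
    finally show ?thesis by (simp add: fm_val_wsum)
  qed
  have fvq: "fv (wsum (qs j)) \<subseteq> {b..<b + m j} \<union> x ` {..<k}" for j
    using \<psi>(2)[of j] m[of j] by (fastforce simp: fv_wsum qs_def)
  have fv: "fv (\<phi> j) \<subseteq> x ` {..<k}" for j
    using fvq[of j] by (auto simp: \<phi>_def fv_infvs)
  have form: "formula L (\<phi> j)" for j
    unfolding \<phi>_def by (intro formula_infvs formula_wsum pos fml)
  have md: "0 \<le> fm_mod L (\<phi> j) (\<lambda>_. t) \<and> fm_mod L (\<phi> j) (\<lambda>_. t) \<le> (real N * real k) * t"
    if t: "0 \<le> t" for j t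
  proof -
    \<comment> \<open>Under the quantifiers the tuple \<open>v\<close> is at distance 0, so \<psi>
      and the discrepancy contribute nothing and each link \<open>d u_i v_i\<close> contributes
      \<open>N * t\<close>.\<close>
    define D where "D = (\<lambda>y. if y \<in> set [b..<b + m j] then 0 else t)"
    have D: "D (b + i) = 0" if "i < m j" for i using that by (simp add: D_def)
    have Dx: "D (x i) = t" if "i < k" for i using x[OF that] by (simp add: D_def)
    have "fm_mod L (\<psi> j) D = fm_mod L (\<psi> j) (\<lambda>_. 0)"
      using \<psi>(2)[of j] by (intro fm_mod_cong) (auto simp: D_def)
    then have D\<psi>: "fm_mod L (\<psi> j) D = 0" using \<psi>(3) by simp
    have nonneg: "0 \<le> fm_mod L (snd (snd q)) D" if "q \<in> set (qs j)" for q
      using that D\<psi> t m[of j] by (auto simp: qs_def D_def)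
    have "(\<Sum>(c, a, \<phi>)\<leftarrow>qs j. c * fm_mod L \<phi> D) =
       (\<Sum>i\<leftarrow>[0..<k]. real N * (D (x i) + D (b + i))) +
       (\<Sum>(i, l)\<leftarrow>List.product [0..<m j] [0..<m j].
          (C j + real N * real k) * (D (b + i) + D (b + l)))"
      by (simp add: qs_def o_def case_prod_beta' D\<psi>)
    also have "\<dots> = (\<Sum>i<k. real N * (D (x i) + D (b + i))) +
       (\<Sum>i<m j. \<Sum>l<m j. (C j + real N * real k) * (D (b + i) + D (b + l)))"
      unfolding sum_list_product by (simp add: interv_sum_list_conv_sum_set_nat atLeast0LessThan)
    also have "\<dots> = (\<Sum>i<k. real N * t) + (\<Sum>i<m j. \<Sum>l<m j. 0)"
      using m[of j] by (intro arg_cong2[of _ _ _ _ "(+)"] sum.cong refl) (auto simp: D Dx)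
    also have "\<dots> = (real N * real k) * t" by simp
    finally show ?thesis
      using fm_mod_wsum[of "qs j" L D, OF pos nonneg] unfolding \<phi>_def fm_mod_infvs D_def[symmetric] by simp
  qed
  have nonneg: "0 \<le> fm_val M (wsum (qs j)) e" for M e j
    using pos by (rule fm_val_wsum_nonneg)
  have bounds: "0 \<le> fm_val M (\<phi> j) e" "fm_val M (\<phi> j) e \<le> 1" for M e j
    using infvs_bounds_less[OF nonneg] order_trans[OF fm_val_infvs_le[OF nonneg] fm_val_wsum_le_1]
    unfolding \<phi>_def by blast+
  have less: "fm_val M (InfN \<phi>) e < r \<longleftrightarrow> \<not> meager (Iso_top p) {g \<in> Iso. act L g M \<in> B \<and>
      real N * (\<Sum>i<k. dist (g (e (x i))) (p i)) < r}" (is "_ \<longleftrightarrow> \<not> meager _ ?S")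
    if M: "M \<in> Mod L" and r: "0 < r" "r \<le> 1" for M :: "('f, 'r, 'u) struct" and e r
  proof -
    have mr: "min 1 t < r \<longleftrightarrow> t < r" for t using r by auto
    have "fm_val M (InfN \<phi>) e < r \<longleftrightarrow> (\<exists>j. fm_val M (\<phi> j) e < r)"
      by (intro fm_val_InfN_less bounds)
    also have "\<dots> \<longleftrightarrow> (\<exists>j e'. (\<forall>y. y \<notin> set [b..<b + m j] \<longrightarrow> e' y = e y) \<and> ?T M j e' < r)"
      unfolding \<phi>_def infvs_bounds_less[OF nonneg, THEN conjunct2] val mr ..
    also have "\<dots> \<longleftrightarrow> \<not> meager (Iso_top p) ?S"
    proof
      assume "\<exists>j e'. (\<forall>y. y \<notin> set [b..<b + m j] \<longrightarrow> e' y = e y) \<and> ?T M j e' < r"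
      then obtain j e' where e': "\<And>y. y \<notin> set [b..<b + m j] \<Longrightarrow> e' y = e y" and T: "?T M j e' < r"
        by blast
      define \<Delta> where "\<Delta> = ?\<delta> j e'"
      define s where "s = (\<Sum>i<k. dist (e' (x i)) (e' (b + i)))"
      \<comment> \<open>\<open>sound\<close> needs a radius above \<Delta>. This one exceeds it so
        little that the extra cost \<open>N * k * (\<eta> - \<Delta>)\<close> stays below the slack
        \<open>r - ?T M j e'\<close>.\<close>
      define \<eta> where "\<eta> = \<Delta> + (r - ?T M j e') / (real N * real k + 1)"
      have Nk: "real N * real k + 1 > 0" by (intro add_nonneg_pos) auto
      have \<Delta>: "0 \<le> \<Delta>" unfolding \<Delta>_def by (rule discrepancy_nonneg)
      have s: "0 \<le> s" unfolding s_def by (intro sum_nonneg) auto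
      have T': "?T M j e' = 1 - fm_val M (\<psi> j) e' + real N * s + C j * \<Delta> + real N * real k * \<Delta>"
        using \<psi>(4)[OF M, of j e'] by (simp add: \<Delta>_def s_def algebra_simps)
      have "0 \<le> real N * s" "0 \<le> real N * real k * \<Delta>" "0 \<le> C j * \<Delta>" using s \<Delta> C by auto
      then have "C j * \<Delta> < fm_val M (\<psi> j) e'" using T r unfolding T' by linarith
      moreover have "\<Delta> < \<eta>" unfolding \<eta>_def using T Nk by simp
      ultimately have nm: "\<not> meager (Iso_top p)
          {g \<in> Iso. act L g M \<in> B \<and> (\<forall>i<m j. dist (g (e' (b + i))) (p i) < \<eta>)}"
        unfolding \<Delta>_def by (intro sound M)
      have N\<eta>: "real N * (s + real k * \<eta>) < r"
      proof -
        have "(real N * real k) * ((r - ?T M j e') / (real N * real k + 1)) < r - ?T M j e'"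
          using T Nk by (simp add: field_simps)
        then have "real N * real k * \<eta> < real N * real k * \<Delta> + (r - ?T M j e')"
          unfolding \<eta>_def by (simp add: distrib_left)
        then show ?thesis
          using \<open>0 \<le> C j * \<Delta>\<close> \<psi>(4)[OF M, of j e'] unfolding T' by (simp add: algebra_simps)
      qed
      have "real N * (\<Sum>i<k. dist (g (e (x i))) (p i)) < r"
        if g: "g \<in> Iso" "\<forall>i<m j. dist (g (e' (b + i))) (p i) < \<eta>" for g
      proof -
        have "(\<Sum>i<k. dist (g (e (x i))) (p i)) \<le> (\<Sum>i<k. dist (e' (x i)) (e' (b + i)) + \<eta>)"
        proof (rule sum_mono)
          fix i assume "i \<in> {..<k}"
          then have i: "i < k" "i < m j" using m[of j] by auto
          have "e (x i) = e' (x i)" using e'[of "x i"] x[OF i(1)] by simp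
          moreover have "dist (g (e' (x i))) (g (e' (b + i))) = dist (e' (x i)) (e' (b + i))"
            using g(1) by (rule Iso_dist)
          moreover have "dist (g (e' (b + i))) (p i) < \<eta>" using g(2) i(2) by blast
          ultimately show "dist (g (e (x i))) (p i) \<le> dist (e' (x i)) (e' (b + i)) + \<eta>"
            using dist_triangle[of "g (e' (x i))" "p i" "g (e' (b + i))"] by simp
        qed
        also have "\<dots> = s + real k * \<eta>" by (simp add: sum.distrib s_def)
        finally show ?thesis
          using N\<eta> mult_left_mono[of _ "s + real k * \<eta>" "real N"] by (metis le_less_trans of_nat_0_le_iff)
      qed
      then have "{g \<in> Iso. act L g M \<in> B \<and> (\<forall>i<m j. dist (g (e' (b + i))) (p i) < \<eta>)} \<subseteq> ?S"
        by blast
      then show "\<not> meager (Iso_top p) ?S" using nm meager_subset by blast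
    next
      assume nm: "\<not> meager (Iso_top p) ?S"
      let ?O = "{g \<in> Iso. real N * (\<Sum>i<k. dist (g (e (x i))) (p i)) < r}"
      have "?S = {g \<in> ?O. act L g M \<in> B}" by auto
      with nm have "\<not> meager (Iso_top p) {g \<in> ?O. act L g M \<in> B}" by (simp only: not_False_eq_True)
      from complete[OF M openin_Iso_top_sum[OF p] this] obtain j g where g: "g \<in> ?O"
          "\<forall>e. (\<forall>i<m j. e (b + i) = inv g (p i)) \<longrightarrow> fm_val M (\<psi> j) e = 1"
        by (elim exE bexE)
      \<comment> \<open>At \<open>g\<^sup>-\<^sup>1 p\<close> the discrepancy vanishes, and the link
        \<open>d u_i v_i\<close> becomes \<open>d (g u_i) p_i\<close>.\<close>
      define e' where "e' y = (if y \<in> set [b..<b + m j] then inv g (p (y - b)) else e y)" for y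
      have e'b: "e' (b + i) = inv g (p i)" if "i < m j" for i
        using that by (simp add: e'_def)
      have e'x: "e' (x i) = e (x i)" if "i < k" for i
        using x[OF that] by (simp add: e'_def)
      have gI: "inv g \<in> Iso" using g(1) by (simp add: inv_in_Iso)
      have "?\<delta> j e' = 0"
        unfolding discrepancy_def by (intro sum.neutral ballI) (simp add: e'b Iso_dist[OF gI])
      moreover have "(\<Sum>i<k. dist (e' (x i)) (e' (b + i))) = (\<Sum>i<k. dist (g (e (x i))) (p i))"
        using g(1) m[of j] by (intro sum.cong refl) (auto simp: e'b e'x Iso_dist_inv)
      moreover have "fm_val M (\<psi> j) e' = 1" using g(2) e'b by blast
      ultimately have "?T M j e' < r" using g(1) by simp
      moreover have "\<forall>y. y \<notin> set [b..<b + m j] \<longrightarrow> e' y = e y" by (simp add: e'_def)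
      ultimately show "\<exists>j e'. (\<forall>y. y \<notin> set [b..<b + m j] \<longrightarrow> e' y = e y) \<and> ?T M j e' < r"
        by blast
    qed
    finally show ?thesis .
  qed
  have "vaught_formula L p B N k x (InfN \<phi>)"
    by (rule vaught_formula_InfN[OF form fv md bounds less])
  then show ?thesis ..
qed

text \<open>If \<open>\<psi> j\<close> has value \<open>r > 0\<close> at \<open>v\<close>, then
  \<open>gM \<in> B\<close> for only meagerly many \<open>g\<close> with
  \<open>K * (\<Sum>i<m. d (g v_i) p_i) < r\<close>. Moving every \<open>v_i\<close> to within
  \<eta>' of \<open>p_i\<close> guarantees this inequality when \<open>K * m * \<eta>' < r\<close>,
  which explains \<open>C = K * m\<close>. Such \<open>g\<close> are nonmeagerly many, so
  nonmeagerly many of them satisfy \<open>gM \<notin> B\<close>. The converse direction is where the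
  property of Baire enters.\<close>

lemma vaught_definable_Compl:
  fixes L :: "('f, 'r) lang" and p :: "nat \<Rightarrow> 'u::polish_space"
  assumes p: "dense_seq p" and U: "urysohn_sphere TYPE('u)"
    and B: "vaught_definable L p B"
    and ao: "\<And>M. M \<in> Mod L \<Longrightarrow> almost_open (Iso_top p) {g \<in> Iso. act L g M \<in> B}"
  shows "vaught_definable L p (- B)"
  unfolding vaught_definable_def
proof (intro allI)
  fix N k :: nat and x :: "nat \<Rightarrow> nat"
  \<comment> \<open>Beyond all \<open>x i\<close>, so that the quantifiers over \<open>v\<close> do
    not capture the variables of \<open>u\<close>.\<close>
  define b where "b = Suc (\<Sum>i<k. x i)"
  have x: "x i < b" if "i < k" for i
    unfolding b_def using that by (intro le_imp_less_Suc member_le_sum) auto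
  \<comment> \<open>The index \<open>j\<close> codes a length and a constant \<open>K\<close>. The
    length is at least \<open>k\<close> because every \<open>u_i\<close> needs a partner
    \<open>v_i\<close>.\<close>
  define m where "m j = k + fst (prod_decode j)" for j
  define K where "K j = snd (prod_decode j)" for j
  \<comment> \<open>\<open>\<psi> j = 1\<close> says that \<open>gM \<in> B\<close> only for meagerly many \<open>g\<close> close to moving \<open>v\<close> onto \<open>p\<close>.\<close>
  have "\<forall>j. \<exists>\<psi>. vaught_formula L p B (K j) (m j) (\<lambda>i. b + i) \<psi>"
    using B unfolding vaught_definable_def by blast
  then obtain \<psi> where \<psi>: "\<And>j. vaught_formula L p B (K j) (m j) (\<lambda>i. b + i) (\<psi> j)" by metis
  have val: "fm_val M (\<psi> j) e \<le> 1" if "M \<in> Mod L" for M :: "('f, 'r, 'u) struct" and j e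
    using \<psi>[of j] that by (simp add: vaught_formula_def)
  have less: "fm_val M (\<psi> j) e < r \<longleftrightarrow> \<not> meager (Iso_top p)
      {g \<in> Iso. act L g M \<in> B \<and> real (K j) * (\<Sum>i<m j. dist (g (e (b + i))) (p i)) < r}"
    if "M \<in> Mod L" "0 < r" "r \<le> 1" for M :: "('f, 'r, 'u) struct" and j e r
    using \<psi>[of j] that by (simp add: vaught_formula_def)
  show "\<exists>\<phi>. vaught_formula L p (- B) N k x \<phi>"
  proof (rule approximation_vaught_formula[OF p x, where m = m and \<psi> = \<psi> and C = "\<lambda>j. real (K j) * real (m j)"])
    fix j
    show "k \<le> m j" "0 \<le> real (K j) * real (m j)" by (auto simp: m_def)
    show "formula L (\<psi> j)" using \<psi>[of j] by (simp add: vaught_formula_def)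
    have "fv (\<psi> j) \<subseteq> (\<lambda>i. b + i) ` {..<m j}" using \<psi>[of j] by (simp add: vaught_formula_def)
    then show "fv (\<psi> j) \<subseteq> {b..<b + m j}" by fastforce
    have "0 \<le> fm_mod L (\<psi> j) (\<lambda>_. 0) \<and> fm_mod L (\<psi> j) (\<lambda>_. 0) \<le> real (K j) * real (m j) * 0"
      using \<psi>[of j] unfolding vaught_formula_def by (meson order_refl)
    then show "fm_mod L (\<psi> j) (\<lambda>_. 0) = 0" by simp
    fix M :: "('f, 'r, 'u) struct" and e :: "nat \<Rightarrow> 'u"
    assume M: "M \<in> Mod L"
    show "fm_val M (\<psi> j) e \<le> 1" by (rule val[OF M])
    let ?v = "\<lambda>i. e (b + i)"
    define \<Delta> where "\<Delta> = discrepancy p (m j) ?v"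
    fix \<eta> assume C: "real (K j) * real (m j) * discrepancy p (m j) ?v < fm_val M (\<psi> j) e"
      and \<eta>: "discrepancy p (m j) ?v < \<eta>"
    define r where "r = fm_val M (\<psi> j) e"
    define C where "C = real (K j) * real (m j)"
    have C0: "0 \<le> C" by (simp add: C_def)
    have r: "0 < r" "r \<le> 1" "C * \<Delta> < r"
      using C val[OF M] discrepancy_nonneg[of p "m j" ?v] by (auto simp: r_def C_def \<Delta>_def intro: le_less_trans[rotated])
    \<comment> \<open>Still above \<Delta>, so that the approximating \<open>g\<close> exist, yet
      with \<open>C * \<eta>' < r\<close>.\<close>
    define \<eta>' where "\<eta>' = min \<eta> (\<Delta> + (r - C * \<Delta>) / (C + 1))"
    have \<eta>': "\<Delta> < \<eta>'" "\<eta>' \<le> \<eta>" using \<eta> r C0 by (auto simp: \<eta>'_def \<Delta>_def)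
    have "C * \<eta>' \<le> C * (\<Delta> + (r - C * \<Delta>) / (C + 1))"
      using C0 by (intro mult_left_mono) (auto simp: \<eta>'_def)
    also have "\<dots> < r"
    proof -
      have "C * ((r - C * \<Delta>) / (C + 1)) < r - C * \<Delta>"
        using r C0 by (simp add: field_simps)
      then show ?thesis by (simp add: distrib_left)
    qed
    finally have C\<eta>': "C * \<eta>' < r" .
    let ?W = "{g \<in> Iso. \<forall>i<m j. dist (g (?v i)) (p i) < \<eta>'}"
    have "\<not> meager (Iso_top p) ?W"
      using \<eta>'(1) unfolding \<Delta>_def by (intro not_meager_near p U)
    moreover have "meager (Iso_top p) (?W \<inter> {g. act L g M \<in> B})"
    proof (rule meager_subset)
      show "meager (Iso_top p) {g \<in> Iso. act L g M \<in> B \<and> real (K j) * (\<Sum>i<m j. dist (g (?v i)) (p i)) < r}"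
        using less[OF M r(1,2), of j e] by (simp add: r_def)
      have "real (K j) * (\<Sum>i<m j. dist (g (?v i)) (p i)) < r" if "g \<in> ?W" for g
      proof -
        have "(\<Sum>i<m j. dist (g (?v i)) (p i)) \<le> (\<Sum>i<m j. \<eta>')"
          using that by (intro sum_mono) (auto simp: less_imp_le)
        then have "real (K j) * (\<Sum>i<m j. dist (g (?v i)) (p i)) \<le> C * \<eta>'"
          unfolding C_def mult.assoc by (intro mult_left_mono) auto
        then show ?thesis using C\<eta>' by simp
      qed
      then show "?W \<inter> {g. act L g M \<in> B} \<subseteq>
          {g \<in> Iso. act L g M \<in> B \<and> real (K j) * (\<Sum>i<m j. dist (g (?v i)) (p i)) < r}"
        by blast
    qed
    ultimately have "\<not> meager (Iso_top p) (?W - {g. act L g M \<in> B})"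
      using meager_Un[of "Iso_top p" "?W \<inter> {g. act L g M \<in> B}" "?W - {g. act L g M \<in> B}"]
      by (metis Int_Diff_Un)
    moreover have "?W - {g. act L g M \<in> B} \<subseteq> {g \<in> Iso. act L g M \<in> - B \<and> (\<forall>i<m j. dist (g (?v i)) (p i) < \<eta>)}"
      using \<eta>'(2) by fastforce
    ultimately show "\<not> meager (Iso_top p) {g \<in> Iso. act L g M \<in> - B \<and> (\<forall>i<m j. dist (g (?v i)) (p i) < \<eta>)}"
      using meager_subset by blast
  next
    fix M :: "('f, 'r, 'u) struct" and S
    assume M: "M \<in> Mod L" and S: "openin (Iso_top p) S"
      and nm: "\<not> meager (Iso_top p) {g \<in> S. act L g M \<in> - B}"
    let ?T = "Iso - {g \<in> Iso. act L g M \<in> B}"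
    have SI: "S \<subseteq> Iso" using openin_subset[OF S] by simp
    have T: "almost_open (Iso_top p) ?T" using almost_open_compl[OF ao[OF M]] by simp
    have "?T \<inter> S = {g \<in> S. act L g M \<in> - B}" using SI by auto
    with nm have nm': "\<not> meager (Iso_top p) (?T \<inter> S)" by (simp only: not_False_eq_True)
    obtain W where W: "openin (Iso_top p) W" "W \<noteq> {}" "W \<subseteq> S" "meager (Iso_top p) (W - ?T)"
      by (rule almost_open_localize[OF T S nm'])
    obtain h where h: "h \<in> W" using W(2) by blast
    obtain m0 \<epsilon> where \<epsilon>: "\<epsilon> > 0" "\<And>g. g \<in> Iso \<Longrightarrow> \<forall>i<m0. dist (g (inv h (p i))) (p i) < \<epsilon> \<Longrightarrow> g \<in> W"
      using Iso_top_nbhd[OF p W(1) h] by metis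
    \<comment> \<open>With this \<open>K0\<close>, a weighted sum below 1 forces each of the first
      \<open>m0\<close> distances below \<epsilon>, hence \<open>g \<in> W\<close>.\<close>
    obtain K0 :: nat where K0: "1 < real K0 * \<epsilon>" using \<epsilon>(1) ex_less_of_nat_mult by blast
    define j where "j = prod_encode (m0, K0)"
    have j: "m j = k + m0" "K j = K0" by (simp_all add: m_def K_def j_def)
    have "fm_val M (\<psi> j) e = 1" if e: "\<forall>i<m j. e (b + i) = inv h (p i)" for e
    proof (rule ccontr)
      assume "fm_val M (\<psi> j) e \<noteq> 1"
      then have "fm_val M (\<psi> j) e < 1" using val[OF M, of j e] by simp
      then have "\<not> meager (Iso_top p)
          {g \<in> Iso. act L g M \<in> B \<and> real (K j) * (\<Sum>i<m j. dist (g (e (b + i))) (p i)) < 1}"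
        using less[OF M, of 1 j e] by simp
      moreover have "g \<in> W - ?T"
        if g: "g \<in> Iso" "act L g M \<in> B" "real (K j) * (\<Sum>i<m j. dist (g (e (b + i))) (p i)) < 1" for g
      proof -
        have "dist (g (inv h (p i))) (p i) < \<epsilon>" if i: "i < m0" for i
        proof -
          have "dist (g (inv h (p i))) (p i) = dist (g (e (b + i))) (p i)" using e i j by simp
          also have "\<dots> \<le> (\<Sum>i<m j. dist (g (e (b + i))) (p i))"
            using i j by (intro member_le_sum) auto
          finally have "real K0 * dist (g (inv h (p i))) (p i) \<le> real (K j) * (\<Sum>i<m j. dist (g (e (b + i))) (p i))"
            unfolding j(2) by (intro mult_left_mono) auto
          then have "real K0 * dist (g (inv h (p i))) (p i) < real K0 * \<epsilon>" using g(3) K0 by linarith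
          then show ?thesis by (simp add: mult_less_cancel_left)
        qed
        then show "g \<in> W - ?T" using \<epsilon>(2)[OF g(1)] g by blast
      qed
      then have "{g \<in> Iso. act L g M \<in> B \<and> real (K j) * (\<Sum>i<m j. dist (g (e (b + i))) (p i)) < 1} \<subseteq> W - ?T"
        by blast
      ultimately show False using W(4) meager_subset by blast
    qed
    then show "\<exists>j. \<exists>g\<in>S. \<forall>e. (\<forall>i<m j. e (b + i) = inv g (p i)) \<longrightarrow> fm_val M (\<psi> j) e = 1"
      using W(3) h by blast
  qed
qed

text \<open>The value of \<open>c\<close> at \<open>gM\<close> is read off in \<open>M\<close> at the points \<open>g\<^sup>-\<^sup>1 p\<^sub>i\<close>.\<close>

definition coordinate_formula ::
    "('f, 'r) lang \<Rightarrow> (nat \<Rightarrow> 'u::metric_space) \<Rightarrow> (('f, 'r, 'u) struct \<Rightarrow> real) \<Rightarrow>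
     nat \<Rightarrow> nat \<Rightarrow> ('f, 'r) fm \<Rightarrow> bool" where
  "coordinate_formula L p c n b \<alpha> \<longleftrightarrow> formula L \<alpha> \<and> fv \<alpha> \<subseteq> {b..<b + n} \<and>
     fm_mod L \<alpha> (\<lambda>_. 0) = 0 \<and>
     (\<forall>M\<in>Mod L. \<forall>g\<in>Iso. \<forall>e. (\<forall>i<n. e (b + i) = inv g (p i)) \<longrightarrow> fm_val M \<alpha> e = c (act L g M)) \<and>
     (\<forall>\<epsilon>>0. \<exists>\<eta>>0. \<forall>M\<in>Mod L. \<forall>e e' :: nat \<Rightarrow> 'u. (\<forall>i<n. dist (e (b + i)) (e' (b + i)) < \<eta>) \<longrightarrow>
        \<bar>fm_val M \<alpha> e - fm_val M \<alpha> e'\<bar> < \<epsilon>)"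

definition atomic_coordinate ::
    "('f, 'r) lang \<Rightarrow> (nat \<Rightarrow> 'u::metric_space) \<Rightarrow> (('f, 'r, 'u) struct \<Rightarrow> real) \<Rightarrow> bool" where
  "atomic_coordinate L p c \<longleftrightarrow> (\<exists>n. \<forall>b. \<exists>\<alpha>. coordinate_formula L p c n b \<alpha>)"

text \<open>The distance from \<open>inv g (p i)\<close> to \<open>inv g0 (p i)\<close> equals that
  from \<open>g (inv g0 (p i))\<close> to \<open>p i\<close>. Hence closeness of \<open>g\<close> to
  \<open>g0\<close> makes the arguments of \<alpha> close, and uniform continuity applies.\<close>

lemma openin_atomic_coordinate:
  fixes L :: "('f, 'r) lang" and p :: "nat \<Rightarrow> 'u::metric_space"
  assumes p: "dense_seq p" and c: "atomic_coordinate L p c" and M: "M \<in> Mod L"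
  shows "openin (Iso_top p) {g \<in> Iso. c (act L g M) < a}" (is "openin _ ?O")
proof (subst openin_subopen, rule ballI)
  fix g0 assume g0: "g0 \<in> ?O"
  obtain n where n: "\<And>b. \<exists>\<alpha>. coordinate_formula L p c n b \<alpha>"
    using c unfolding atomic_coordinate_def by blast
  from n[of 0] obtain \<alpha> where \<alpha>: "coordinate_formula L p c n 0 \<alpha>" by blast
  have v: "fm_val M \<alpha> e = c (act L g M)" if "g \<in> Iso" "\<forall>i<n. e i = inv g (p i)" for g e
    using \<alpha> M that by (simp add: coordinate_formula_def)
  have u: "\<forall>\<epsilon>>0. \<exists>\<eta>>0. \<forall>M\<in>Mod L. \<forall>e e' :: nat \<Rightarrow> 'u. (\<forall>i<n. dist (e i) (e' i) < \<eta>) \<longrightarrow>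
        \<bar>fm_val M \<alpha> e - fm_val M \<alpha> e'\<bar> < \<epsilon>"
    using \<alpha> by (simp add: coordinate_formula_def)
  have "0 < a - c (act L g0 M)" using g0 by simp
  from u[rule_format, OF this] obtain \<eta> where \<eta>0: "\<eta> > 0"
      "\<forall>M'\<in>Mod L. \<forall>e e' :: nat \<Rightarrow> 'u. (\<forall>i<n. dist (e i) (e' i) < \<eta>) \<longrightarrow>
        \<bar>fm_val M' \<alpha> e - fm_val M' \<alpha> e'\<bar> < a - c (act L g0 M)" by (elim exE conjE)
  note \<eta> = \<eta>0(1) \<eta>0(2)[rule_format, OF M]
  let ?W = "{g \<in> Iso. \<forall>i<n. dist (g (inv g0 (p i))) (p i) < \<eta>}"
  have "g \<in> ?O" if g: "g \<in> ?W" for g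
  proof -
    have "dist (inv g (p i)) (inv g0 (p i)) < \<eta>" if "i < n" for i
      using g that by (subst dist_commute) (simp add: Iso_dist_inv)
    then have "\<bar>fm_val M \<alpha> (\<lambda>i. inv g (p i)) - fm_val M \<alpha> (\<lambda>i. inv g0 (p i))\<bar> < a - c (act L g0 M)"
      by (intro \<eta>(2)) simp
    moreover have "fm_val M \<alpha> (\<lambda>i. inv g (p i)) = c (act L g M)" "fm_val M \<alpha> (\<lambda>i. inv g0 (p i)) = c (act L g0 M)"
      using g g0 by (intro v; simp)+
    ultimately show ?thesis using g by simp
  qed
  moreover have "g0 \<in> ?W" using g0 \<eta>(1) by simp
  ultimately show "\<exists>T. openin (Iso_top p) T \<and> g0 \<in> T \<and> T \<subseteq> ?O"
    using openin_Iso_top_balls[OF p, of n "\<lambda>i. inv g0 (p i)" p \<eta>] by blast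
qed

text \<open>Base of the induction. A tuple \<open>v\<close> certifies
  \<open>c (act L g M) < a\<close> if \<alpha> is below \<open>a\<close> at \<open>v\<close> by some
  margin and \<open>g\<close> moves \<open>v\<close> so close to \<open>p\<close> that \<alpha>
  changes by less than the margin. The choice \<open>C j = 1 / H j\<close> encodes the closeness:
  \<open>C j * \<Delta> < 1\<close> means \<open>\<Delta> < H j\<close>.\<close>

lemma vaught_definable_atomic_coordinate:
  fixes L :: "('f, 'r) lang" and p :: "nat \<Rightarrow> 'u::polish_space"
  assumes p: "dense_seq p" and U: "urysohn_sphere TYPE('u)" and c: "atomic_coordinate L p c"
  shows "vaught_definable L p {M. c M < a}"
  unfolding vaught_definable_def
proof (intro allI)
  fix N k :: nat and x :: "nat \<Rightarrow> nat"
  define b where "b = Suc (\<Sum>i<k. x i)"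
  have x: "x i < b" if "i < k" for i
    unfolding b_def using that by (intro le_imp_less_Suc member_le_sum) auto
  obtain n where n: "\<And>b. \<exists>\<alpha>. coordinate_formula L p c n b \<alpha>"
    using c unfolding atomic_coordinate_def by blast
  from n[of b] obtain \<alpha> where \<alpha>': "coordinate_formula L p c n b \<alpha>" by blast
  then have \<alpha>: "formula L \<alpha>" "fv \<alpha> \<subseteq> {b..<b + n}" "fm_mod L \<alpha> (\<lambda>_. 0) = 0"
    and u: "\<forall>\<epsilon>>0. \<exists>\<eta>>0. \<forall>M\<in>Mod L. \<forall>e e' :: nat \<Rightarrow> 'u. (\<forall>i<n. dist (e (b + i)) (e' (b + i)) < \<eta>) \<longrightarrow>
        \<bar>fm_val M \<alpha> e - fm_val M \<alpha> e'\<bar> < \<epsilon>"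
    unfolding coordinate_formula_def by simp_all
  have v: "fm_val M \<alpha> e = c (act L g M)"
    if "M \<in> Mod L" "g \<in> Iso" "\<forall>i<n. e (b + i) = inv g (p i)" for M g e
    using \<alpha>' that by (simp add: coordinate_formula_def)
  have "\<forall>j::nat. \<exists>\<eta>>0. \<forall>M\<in>Mod L. \<forall>e e' :: nat \<Rightarrow> 'u. (\<forall>i<n. dist (e (b + i)) (e' (b + i)) < \<eta>) \<longrightarrow>
        \<bar>fm_val M \<alpha> e - fm_val M \<alpha> e'\<bar> < 1 / (2 * real (Suc j))"
    using u by simp
  then obtain H where H: "\<And>j. H j > 0" "\<And>j M (e :: nat \<Rightarrow> 'u) e'. M \<in> Mod L \<Longrightarrow>
        \<forall>i<n. dist (e (b + i)) (e' (b + i)) < H j \<Longrightarrow>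
        \<bar>fm_val M \<alpha> e - fm_val M \<alpha> e'\<bar> < 1 / (2 * real (Suc j))"
    by (metis (no_types, lifting))
  \<comment> \<open>A continuous cutoff: 1 where the margin \<open>a - z 0\<close> is at least
    \<open>1 / (j + 1)\<close>, and 0 where it is at most half of that. \<open>H j\<close> is the
    displacement that this half absorbs.\<close>
  define h where "h j z = max 0 (min 1 (2 * real (Suc j) * (a - z 0) - 1))" for j and z :: "nat \<Rightarrow> real"
  define \<psi> where "\<psi> j = Conn (h j) [\<alpha>]" for j
  have val: "fm_val M (\<psi> j) e = max 0 (min 1 (2 * real (Suc j) * (a - fm_val M \<alpha> e) - 1))"
    for M :: "('f, 'r, 'u) struct" and j e
    by (simp add: \<psi>_def h_def tuple_def)
  show "\<exists>\<phi>. vaught_formula L p {M. c M < a} N k x \<phi>"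
  proof (rule approximation_vaught_formula[OF p x, where m = "\<lambda>_. k + n" and \<psi> = \<psi> and C = "\<lambda>j. 1 / H j"])
    fix j
    show "k \<le> k + n" "0 \<le> 1 / H j" using H(1)[of j] by auto
    have "continuous_on S (h j)" for S
      unfolding h_def
      by (intro continuous_intros continuous_on_subset[OF continuous_on_product_coordinates]) auto
    then have "connective 1 (h j)" by (auto simp: connective_def h_def)
    then show "formula L (\<psi> j)" unfolding \<psi>_def using \<alpha>(1) by (intro formula.intros) auto
    show "fv (\<psi> j) \<subseteq> {b..<b + (k + n)}" using \<alpha>(2) by (auto simp: \<psi>_def)
    have "0 \<le> conn_mod (h j) [0] \<and> conn_mod (h j) [0] \<le> 0"
      by (rule conn_mod_bounds) (auto simp: h_def)
    then show "fm_mod L (\<psi> j) (\<lambda>_. 0) = 0" by (simp add: \<psi>_def \<alpha>(3))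
    fix M :: "('f, 'r, 'u) struct" and e :: "nat \<Rightarrow> 'u"
    assume M: "M \<in> Mod L"
    show "fm_val M (\<psi> j) e \<le> 1" by (simp add: val)
    let ?v = "\<lambda>i. e (b + i)"
    define \<Delta> where "\<Delta> = discrepancy p (k + n) ?v"
    fix \<eta> assume C: "1 / H j * discrepancy p (k + n) ?v < fm_val M (\<psi> j) e"
      and \<eta>: "discrepancy p (k + n) ?v < \<eta>"
    have "0 \<le> \<Delta>" by (simp add: \<Delta>_def discrepancy_nonneg)
    then have "0 \<le> 1 / H j * \<Delta>" using H(1)[of j] by (intro mult_nonneg_nonneg) auto
    then have pos: "0 < fm_val M (\<psi> j) e" using C by (simp add: \<Delta>_def)
    then have "1 < 2 * real (Suc j) * (a - fm_val M \<alpha> e)" unfolding val by simp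
    then have small: "fm_val M \<alpha> e < a - 1 / (2 * real (Suc j))" by (simp add: field_simps)
    have "fm_val M (\<psi> j) e \<le> 1" by (simp add: val)
    then have "1 / H j * \<Delta> < 1" using C unfolding \<Delta>_def by linarith
    then have "\<Delta> < H j" using H(1)[of j] by (simp add: field_simps)
    then have \<eta>': "\<Delta> < min \<eta> (H j)" using \<eta> by (simp add: \<Delta>_def)
    let ?W = "{g \<in> Iso. \<forall>i<k + n. dist (g (?v i)) (p i) < min \<eta> (H j)}"
    have "\<not> meager (Iso_top p) ?W"
      using \<eta>' unfolding \<Delta>_def by (intro not_meager_near p U)
    moreover have "c (act L g M) < a"
      if g: "g \<in> Iso" "\<forall>i<k + n. dist (g (?v i)) (p i) < min \<eta> (H j)" for g
    proof -
      have "dist (e (b + i)) (inv g (p (b + i - b))) < H j" if "i < n" for i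
        using g that by (simp add: Iso_dist_inv)
      then have "\<bar>fm_val M \<alpha> e - fm_val M \<alpha> (\<lambda>i. inv g (p (i - b)))\<bar> < 1 / (2 * real (Suc j))"
        by (intro H(2)[OF M]) blast
      moreover have "fm_val M \<alpha> (\<lambda>i. inv g (p (i - b))) = c (act L g M)"
        by (rule v[OF M g(1)]) simp
      ultimately show ?thesis using small by linarith
    qed
    then have "?W \<subseteq> {g \<in> Iso. act L g M \<in> {M. c M < a} \<and> (\<forall>i<k + n. dist (g (?v i)) (p i) < \<eta>)}"
      by auto
    ultimately show "\<not> meager (Iso_top p)
        {g \<in> Iso. act L g M \<in> {M. c M < a} \<and> (\<forall>i<k + n. dist (g (?v i)) (p i) < \<eta>)}"
      using meager_subset by blast
  next
    fix M :: "('f, 'r, 'u) struct" and S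
    assume M: "M \<in> Mod L" and S: "openin (Iso_top p) S"
      and nm: "\<not> meager (Iso_top p) {g \<in> S. act L g M \<in> {M. c M < a}}"
    then have "{g \<in> S. act L g M \<in> {M. c M < a}} \<noteq> {}" using meager_empty by metis
    then obtain g where g: "g \<in> S" "c (act L g M) < a" by blast
    then have gI: "g \<in> Iso" using openin_subset[OF S] by auto
    obtain j :: nat where j: "1 < real j * (a - c (act L g M))"
      using g(2) ex_less_of_nat_mult[of "a - c (act L g M)" 1] by auto
    have "fm_val M (\<psi> j) e = 1" if "\<forall>i<k + n. e (b + i) = inv g (p i)" for e
    proof -
      have "fm_val M \<alpha> e = c (act L g M)" using that by (intro v[OF M gI]) simp
      moreover have "real j * (a - c (act L g M)) \<le> real (Suc j) * (a - c (act L g M))"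
        using g(2) by (intro mult_right_mono) auto
      ultimately show ?thesis using j unfolding val mult.assoc by simp
    qed
    then show "\<exists>j. \<exists>g\<in>S. \<forall>e. (\<forall>i<k + n. e (b + i) = inv g (p i)) \<longrightarrow> fm_val M (\<psi> j) e = 1"
      using g(1) by blast
  qed
qed

subsection \<open>Countably many coordinates generate the Borel sets\<close>

lemma modulus_small:
  assumes "modulus w" "\<epsilon> > 0"
  obtains \<eta> where "\<eta> > 0" "\<And>t. 0 \<le> t \<Longrightarrow> t < \<eta> \<Longrightarrow> w t < \<epsilon>"
proof -
  have "continuous_on {0..} w" "w 0 = 0" using assms(1) by (auto simp: modulus_def)
  then obtain \<eta> where \<eta>: "\<eta> > 0" "\<And>t. t \<in> {0..} \<Longrightarrow> dist t 0 < \<eta> \<Longrightarrow> dist (w t) (w 0) < \<epsilon>"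
    unfolding continuous_on_iff using assms(2) by (metis atLeast_iff order_refl)
  show thesis
  proof
    show "w t < \<epsilon>" if "0 \<le> t" "t < \<eta>" for t
      using \<eta>(2)[of t] that \<open>w 0 = 0\<close> by (simp add: dist_real_def)
  qed fact
qed

lemma max_dist_less:
  assumes "\<eta> > 0" "\<And>i. i < n \<Longrightarrow> dist (x i) (y i) < \<eta>"
  shows "0 \<le> max_dist n x y" "max_dist n x y < \<eta>"
  using assms unfolding max_dist_def by (auto intro: Max_ge)

lemma tuple_mem: "tuple xs \<in> tuples (length xs) UNIV"
  by (auto simp: tuple_def)

lemma tuple_nth: "i < length xs \<Longrightarrow> tuple xs i = xs ! i"
  by (simp add: tuple_def)

lemma Mod_fun_dist:
  assumes "M \<in> Mod L" "f \<in> Funs L" "x \<in> tuples (far L f) UNIV" "y \<in> tuples (far L f) UNIV"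
  shows "dist (fst M f x) (fst M f y) \<le> fmod L f (max_dist (far L f) x y)"
proof -
  have "fst M f \<in> Unif (fmod L f) (far L f) UNIV"
    using assms(1,2) by (auto simp: Mod_def)
  then show ?thesis using assms(3,4) unfolding Unif_def by blast
qed

lemma Mod_rel_dist:
  assumes "M \<in> Mod L" "r \<in> Rels L" "x \<in> tuples (rar L r) UNIV" "y \<in> tuples (rar L r) UNIV"
  shows "dist (snd M r x) (snd M r y) \<le> rmod L r (max_dist (rar L r) x y)"
proof -
  have "snd M r \<in> Unif (rmod L r) (rar L r) {0..1}"
    using assms(1,2) by (auto simp: Mod_def)
  then show ?thesis using assms(3,4) unfolding Unif_def by blast
qed

text \<open>The radius is chosen before the structure, since the modulus belongs to the language;
  \<open>coordinate_formula\<close> requires this uniformity.\<close>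

lemma Mod_fun_uniform:
  fixes L :: "('f, 'r) lang"
  assumes "language L" "f \<in> Funs L" "\<epsilon> > 0"
  obtains \<eta> where "\<eta> > 0" "\<And>(M :: ('f, 'r, 'u::metric_space) struct) x y. M \<in> Mod L \<Longrightarrow>
    x \<in> tuples (far L f) UNIV \<Longrightarrow> y \<in> tuples (far L f) UNIV \<Longrightarrow>
    (\<And>i. i < far L f \<Longrightarrow> dist (x i) (y i) < \<eta>) \<Longrightarrow> dist (fst M f x) (fst M f y) < \<epsilon>"
proof -
  have "modulus (fmod L f)" using assms by (simp add: language_def)
  then obtain \<eta> where \<eta>: "\<eta> > 0" "\<And>t. 0 \<le> t \<Longrightarrow> t < \<eta> \<Longrightarrow> fmod L f t < \<epsilon>"
    using assms(3) by (rule modulus_small) blast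
  show thesis
    by (rule that[OF \<eta>(1)])
      (rule le_less_trans[OF Mod_fun_dist[OF _ assms(2)] \<eta>(2)[OF max_dist_less[OF \<eta>(1)]]])
qed

lemma Mod_rel_uniform:
  fixes L :: "('f, 'r) lang"
  assumes "language L" "r \<in> Rels L" "\<epsilon> > 0"
  obtains \<eta> where "\<eta> > 0" "\<And>(M :: ('f, 'r, 'u::metric_space) struct) x y. M \<in> Mod L \<Longrightarrow>
    x \<in> tuples (rar L r) UNIV \<Longrightarrow> y \<in> tuples (rar L r) UNIV \<Longrightarrow>
    (\<And>i. i < rar L r \<Longrightarrow> dist (x i) (y i) < \<eta>) \<Longrightarrow> dist (snd M r x) (snd M r y) < \<epsilon>"
proof -
  have "modulus (rmod L r)" using assms by (simp add: language_def)
  then obtain \<eta> where \<eta>: "\<eta> > 0" "\<And>t. 0 \<le> t \<Longrightarrow> t < \<eta> \<Longrightarrow> rmod L r t < \<epsilon>"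
    using assms(3) by (rule modulus_small) blast
  show thesis
    by (rule that[OF \<eta>(1)])
      (rule le_less_trans[OF Mod_rel_dist[OF _ assms(2)] \<eta>(2)[OF max_dist_less[OF \<eta>(1)]]])
qed

lemma pull_tuple: "length is = n \<Longrightarrow> pull g n (tuple (map p is)) = tuple (map (\<lambda>i. inv g (p i)) is)"
  by (auto simp: pull_def tuple_def restrict_def)

lemma act_fun:
  assumes "f \<in> Funs L" "length is = far L f"
  shows "fst (act L g M) f (tuple (map p is)) = g (fst M f (tuple (map (\<lambda>i. inv g (p i)) is)))"
  using assms tuple_mem[of "map p is"] by (simp add: act_def pull_tuple)

lemma act_rel:
  assumes "r \<in> Rels L" "length is = rar L r"
  shows "snd (act L g M) r (tuple (map p is)) = snd M r (tuple (map (\<lambda>i. inv g (p i)) is))"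
  using assms tuple_mem[of "map p is"] by (simp add: act_def pull_tuple)

lemma max0_eq_0:
  assumes "\<And>x. x \<in> set xs \<Longrightarrow> x = 0"
  shows "max0 xs = 0"
proof -
  have "insert 0 (set xs) = {0}" using assms by auto
  then show ?thesis unfolding max0_def by (simp only: Max_singleton)
qed

lemma mono_mod_0: "modulus w \<Longrightarrow> mono_mod w 0 = 0"
  by (simp add: mono_mod_def modulus_def)

definition fun_coordinate :: "(nat \<Rightarrow> 'u::metric_space) \<Rightarrow> 'f \<Rightarrow> nat list \<Rightarrow> nat \<Rightarrow> ('f, 'r, 'u) struct \<Rightarrow> real" where
  "fun_coordinate p f is j M = dist (fst M f (tuple (map p is))) (p j)"

definition rel_coordinate :: "(nat \<Rightarrow> 'u) \<Rightarrow> 'r \<Rightarrow> nat list \<Rightarrow> ('f, 'r, 'u) struct \<Rightarrow> real" where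
  "rel_coordinate p r is M = snd M r (tuple (map p is))"

text \<open>Since \<open>g\<close> is an isometry, the distance of
  \<open>g (f (g\<^sup>-\<^sup>1 p_is))\<close> from \<open>p_j\<close> equals that of
  \<open>f (g\<^sup>-\<^sup>1 p_is)\<close> from \<open>g\<^sup>-\<^sup>1 p_j\<close>, so the
  coordinate at \<open>gM\<close> is an atomic formula in \<open>M\<close>.\<close>

lemma atomic_fun_coordinate:
  fixes L :: "('f, 'r) lang" and p :: "nat \<Rightarrow> 'u::metric_space"
  assumes L: "language L" and f: "f \<in> Funs L" and len: "length is = far L f"
  shows "atomic_coordinate L p (fun_coordinate p f is j)"
  unfolding atomic_coordinate_def
proof (intro exI allI)
  fix b
  \<comment> \<open>Exceeds \<open>j\<close> and every entry of \<open>is\<close>.\<close>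
  let ?n = "Suc (j + sum_list is)"
  let ?\<alpha> = "Dist (App f (map (\<lambda>i. Var (b + i)) is)) (Var (b + j)) :: ('f, 'r) fm"
  have is_less: "i < ?n" if "i \<in> set is" for i
    using member_le_sum_list[of i "is"] that by simp
  have val: "fm_val M ?\<alpha> e = dist (fst M f (tuple (map (\<lambda>i. e (b + i)) is))) (e (b + j))"
    for M :: "('f, 'r, 'u) struct" and e by (simp add: o_def)
  show "coordinate_formula L p (fun_coordinate p f is j) ?n b ?\<alpha>"
    unfolding coordinate_formula_def
  proof (intro conjI ballI allI impI)
    show "formula L ?\<alpha>" using f len by (auto intro!: formula.intros is_term.intros)
    show "fv ?\<alpha> \<subseteq> {b..<b + ?n}" using is_less by auto
    have "modulus (fmod L f)" using L f by (simp add: language_def)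
    moreover have "max0 (map (\<lambda>_. 0) is) = 0" by (rule max0_eq_0) auto
    ultimately show "fm_mod L ?\<alpha> (\<lambda>_. 0) = 0"
      by (simp add: o_def mono_mod_0)
  next
    fix M :: "('f, 'r, 'u) struct" and g and e :: "nat \<Rightarrow> 'u"
    assume g: "g \<in> Iso" and e: "\<forall>i<?n. e (b + i) = inv g (p i)"
    have eq: "map (\<lambda>i. e (b + i)) is = map (\<lambda>i. inv g (p i)) is"
      using e is_less by (intro map_cong refl) blast
    have "e (b + j) = inv g (p j)" using e by simp
    then show "fm_val M ?\<alpha> e = fun_coordinate p f is j (act L g M)"
      unfolding val eq by (simp add: fun_coordinate_def act_fun[OF f len] Iso_dist_inv[OF g])
  next
    fix \<epsilon> :: real assume \<epsilon>: "\<epsilon> > 0"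
    obtain \<eta> where \<eta>: "\<eta> > 0" "\<And>(M :: ('f, 'r, 'u) struct) x y. M \<in> Mod L \<Longrightarrow>
        x \<in> tuples (far L f) UNIV \<Longrightarrow> y \<in> tuples (far L f) UNIV \<Longrightarrow>
        (\<And>i. i < far L f \<Longrightarrow> dist (x i) (y i) < \<eta>) \<Longrightarrow> dist (fst M f x) (fst M f y) < \<epsilon> / 2"
      by (rule Mod_fun_uniform[OF L f half_gt_zero[OF \<epsilon>]]) blast
    have "\<bar>fm_val M ?\<alpha> e - fm_val M ?\<alpha> e'\<bar> < \<epsilon>"
      if M: "M \<in> Mod L" and e: "\<forall>i<?n. dist (e (b + i)) (e' (b + i)) < min \<eta> (\<epsilon> / 2)"
      for M :: "('f, 'r, 'u) struct" and e e'
    proof -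
      let ?t = "\<lambda>e. tuple (map (\<lambda>i. e (b + i)) is)"
      have "dist (fst M f (?t e)) (fst M f (?t e')) < \<epsilon> / 2"
      proof (rule \<eta>(2)[OF M])
        fix i assume "i < far L f"
        then have "i < length is" using len by simp
        then show "dist (?t e i) (?t e' i) < \<eta>"
          using e is_less[OF nth_mem] by (simp add: tuple_nth)
      qed (use len tuple_mem[of "map _ is"] in \<open>simp_all add: tuple_def\<close>)
      moreover have "dist (e (b + j)) (e' (b + j)) < \<epsilon> / 2" using e by simp
      ultimately show ?thesis unfolding val by metric
    qed
    then show "\<exists>\<eta>>0. \<forall>M\<in>Mod L. \<forall>e e' :: nat \<Rightarrow> 'u. (\<forall>i<?n. dist (e (b + i)) (e' (b + i)) < \<eta>) \<longrightarrow>
        \<bar>fm_val M ?\<alpha> e - fm_val M ?\<alpha> e'\<bar> < \<epsilon>"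
      using \<eta>(1) \<epsilon> by (intro exI[of _ "min \<eta> (\<epsilon> / 2)"] conjI ballI allI impI) auto
  qed
qed

lemma atomic_rel_coordinate:
  fixes L :: "('f, 'r) lang" and p :: "nat \<Rightarrow> 'u::metric_space"
  assumes L: "language L" and r: "r \<in> Rels L" and len: "length is = rar L r"
  shows "atomic_coordinate L p (rel_coordinate p r is)"
  unfolding atomic_coordinate_def
proof (intro exI allI)
  fix b
  let ?n = "Suc (sum_list is)"
  let ?\<alpha> = "Rel r (map (\<lambda>i. Var (b + i)) is) :: ('f, 'r) fm"
  have is_less: "i < ?n" if "i \<in> set is" for i
    using member_le_sum_list[of i "is"] that by simp
  have val: "fm_val M ?\<alpha> e = snd M r (tuple (map (\<lambda>i. e (b + i)) is))"
    for M :: "('f, 'r, 'u) struct" and e by (simp add: o_def)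
  show "coordinate_formula L p (rel_coordinate p r is) ?n b ?\<alpha>"
    unfolding coordinate_formula_def
  proof (intro conjI ballI allI impI)
    show "formula L ?\<alpha>" using r len by (auto intro!: formula.intros is_term.intros)
    show "fv ?\<alpha> \<subseteq> {b..<b + ?n}" using is_less by auto
    have "modulus (rmod L r)" using L r by (simp add: language_def)
    moreover have "max0 (map (\<lambda>_. 0) is) = 0" by (rule max0_eq_0) auto
    ultimately show "fm_mod L ?\<alpha> (\<lambda>_. 0) = 0"
      by (simp add: o_def mono_mod_0)
  next
    fix M :: "('f, 'r, 'u) struct" and g and e :: "nat \<Rightarrow> 'u"
    assume g: "g \<in> Iso" and e: "\<forall>i<?n. e (b + i) = inv g (p i)"
    have eq: "map (\<lambda>i. e (b + i)) is = map (\<lambda>i. inv g (p i)) is"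
      using e is_less by (intro map_cong refl) blast
    show "fm_val M ?\<alpha> e = rel_coordinate p r is (act L g M)"
      unfolding val eq by (simp add: rel_coordinate_def act_rel[OF r len])
  next
    fix \<epsilon> :: real assume \<epsilon>: "\<epsilon> > 0"
    obtain \<eta> where \<eta>: "\<eta> > 0" "\<And>(M :: ('f, 'r, 'u) struct) x y. M \<in> Mod L \<Longrightarrow>
        x \<in> tuples (rar L r) UNIV \<Longrightarrow> y \<in> tuples (rar L r) UNIV \<Longrightarrow>
        (\<And>i. i < rar L r \<Longrightarrow> dist (x i) (y i) < \<eta>) \<Longrightarrow> dist (snd M r x) (snd M r y) < \<epsilon>"
      by (rule Mod_rel_uniform[OF L r \<epsilon>]) blast
    have "\<bar>fm_val M ?\<alpha> e - fm_val M ?\<alpha> e'\<bar> < \<epsilon>"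
      if M: "M \<in> Mod L" and e: "\<forall>i<?n. dist (e (b + i)) (e' (b + i)) < \<eta>"
      for M :: "('f, 'r, 'u) struct" and e e'
    proof -
      let ?t = "\<lambda>e. tuple (map (\<lambda>i. e (b + i)) is)"
      have "dist (snd M r (?t e)) (snd M r (?t e')) < \<epsilon>"
      proof (rule \<eta>(2)[OF M])
        fix i assume "i < rar L r"
        then have "i < length is" using len by simp
        then show "dist (?t e i) (?t e' i) < \<eta>"
          using e is_less[OF nth_mem] by (simp add: tuple_nth)
      qed (use len tuple_mem[of "map _ is"] in \<open>simp_all add: tuple_def\<close>)
      then show ?thesis unfolding val by (simp add: dist_real_def)
    qed
    then show "\<exists>\<eta>>0. \<forall>M\<in>Mod L. \<forall>e e' :: nat \<Rightarrow> 'u. (\<forall>i<?n. dist (e (b + i)) (e' (b + i)) < \<eta>) \<longrightarrow>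
        \<bar>fm_val M ?\<alpha> e - fm_val M ?\<alpha> e'\<bar> < \<epsilon>"
      using \<eta>(1) by (intro exI[of _ \<eta>] conjI ballI allI impI) auto
  qed
qed

lemma atomic_zero_coordinate:
  fixes L :: "('f, 'r) lang" and p :: "nat \<Rightarrow> 'u::metric_space"
  shows "atomic_coordinate L p (\<lambda>_. 0)"
  unfolding atomic_coordinate_def
proof (intro exI allI)
  fix b
  show "coordinate_formula L p (\<lambda>_. 0) 1 b (Dist (Var b) (Var b))"
    unfolding coordinate_formula_def
    by (auto intro!: formula.intros is_term.intros exI[of _ 1])
qed

text \<open>The constant coordinate keeps the set nonempty when the language has no symbols.\<close>

definition coordinates :: "('f, 'r) lang \<Rightarrow> (nat \<Rightarrow> 'u::metric_space) \<Rightarrow> (('f, 'r, 'u) struct \<Rightarrow> real) set" where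
  "coordinates L p = insert (\<lambda>_. 0)
     ({fun_coordinate p f is j | f is j. f \<in> Funs L \<and> length is = far L f} \<union>
      {rel_coordinate p r is | r is. r \<in> Rels L \<and> length is = rar L r})"

text \<open>Coding by real sequences replaces an ambient product indexed by all tuples, which need
  not be second countable, by a space whose Borel sets are generated by countably many
  half-spaces.\<close>

definition struct_code :: "('f, 'r) lang \<Rightarrow> (nat \<Rightarrow> 'u::metric_space) \<Rightarrow> ('f, 'r, 'u) struct \<Rightarrow> nat \<Rightarrow> real" where
  "struct_code L p M n = from_nat_into (coordinates L p) n M"

lemma countable_coordinates:
  assumes "countable_language L"
  shows "countable (coordinates L p)"
proof -
  have F: "{fun_coordinate p f is j | f is j. f \<in> Funs L \<and> length is = far L f} \<subseteq>
      (\<lambda>(f, is, j). fun_coordinate p f is j) ` (Funs L \<times> UNIV \<times> UNIV)"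
  proof clarify
    fix f "is" j assume "f \<in> Funs L"
    then show "fun_coordinate p f is j \<in> (\<lambda>(f, is, j). fun_coordinate p f is j) ` (Funs L \<times> UNIV \<times> UNIV)"
      by (intro image_eqI[of _ _ "(f, is, j)"]) auto
  qed
  have R: "{rel_coordinate p r is | r is. r \<in> Rels L \<and> length is = rar L r} \<subseteq>
      (\<lambda>(r, is). rel_coordinate p r is) ` (Rels L \<times> UNIV)"
  proof clarify
    fix r "is" assume "r \<in> Rels L"
    then show "rel_coordinate p r is \<in> (\<lambda>(r, is). rel_coordinate p r is) ` (Rels L \<times> UNIV)"
      by (intro image_eqI[of _ _ "(r, is)"]) auto
  qed
  have "countable (Funs L)" "countable (Rels L)"
    using assms by (auto simp: countable_language_def)
  then have "countable (Funs L \<times> (UNIV :: nat list set) \<times> (UNIV :: nat set))"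
      "countable (Rels L \<times> (UNIV :: nat list set))"
    by (intro countable_SIGMA; simp)+
  then show ?thesis
    unfolding coordinates_def countable_insert_eq countable_Un_iff
    using countable_subset[OF F countable_image] countable_subset[OF R countable_image] by blast
qed

lemma atomic_coordinates:
  assumes "language L" "c \<in> coordinates L p"
  shows "atomic_coordinate L p c"
  using assms atomic_fun_coordinate[of L] atomic_rel_coordinate[of L] atomic_zero_coordinate[of L]
  unfolding coordinates_def by blast

lemma code_in_coordinates: "(\<lambda>M. struct_code L p M n) \<in> coordinates L p"
proof -
  have "coordinates L p \<noteq> {}" by (simp add: coordinates_def)
  then have "from_nat_into (coordinates L p) n \<in> coordinates L p" by (rule from_nat_into)
  then show ?thesis by (simp add: struct_code_def[abs_def])
qed

lemma coordinate_eq_code: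
  assumes "countable_language L" "c \<in> coordinates L p"
  obtains n where "\<And>M. struct_code L p M n = c M"
  using from_nat_into_surj[OF countable_coordinates[OF assms(1)] assms(2)] unfolding struct_code_def by metis

lemma continuous_map_metricI:
  fixes h :: "'a \<Rightarrow> 'b::metric_space"
  assumes "\<And>x \<epsilon>. x \<in> topspace X \<Longrightarrow> \<epsilon> > 0 \<Longrightarrow>
    \<exists>U. openin X U \<and> x \<in> U \<and> (\<forall>y\<in>U. dist (h y) (h x) < \<epsilon>)"
  shows "continuous_map X euclidean h"
  unfolding continuous_map_def
proof (intro conjI allI impI)
  fix V :: "'b set" assume V: "openin euclidean V"
  show "openin X {x \<in> topspace X. h x \<in> V}"
  proof (subst openin_subopen, rule ballI)
    fix x assume "x \<in> {x \<in> topspace X. h x \<in> V}"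
    then have x: "x \<in> topspace X" "h x \<in> V" by auto
    then obtain \<epsilon> where \<epsilon>: "\<epsilon> > 0" "\<And>y. dist y (h x) < \<epsilon> \<Longrightarrow> y \<in> V"
      using V unfolding open_openin[symmetric] open_dist by blast
    obtain U where U: "openin X U" "x \<in> U" "\<forall>y\<in>U. dist (h y) (h x) < \<epsilon>"
      using assms[OF x(1) \<epsilon>(1)] by blast
    then show "\<exists>T. openin X T \<and> x \<in> T \<and> T \<subseteq> {x \<in> topspace X. h x \<in> V}"
      using \<epsilon>(2) openin_subset[OF U(1)] by (intro exI[of _ U]) auto
  qed
qed auto

lemma dense_tuple:
  assumes "dense_seq p" "\<eta> > 0"
  obtains "is" where "length is = n" "\<And>i. i < n \<Longrightarrow> dist (x i) (tuple (map p is) i) < \<eta>"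
proof -
  have "\<forall>i. \<exists>k. dist (x i) (p k) < \<eta>" using assms dense_seqD by blast
  then obtain s where "\<And>i. dist (x i) (p (s i)) < \<eta>" by metis
  then show thesis by (intro that[of "map s [0..<n]"]) (auto simp: tuple_def)
qed

text \<open>On \<open>Mod L\<close> the value of a symbol at any tuple is approximated, uniformly in
  the structure, by its value at a tuple from \<open>p\<close>. So the countably many coordinates
  already determine the trace topology: the inclusion is continuous for the topology pulled back
  along the code.\<close>

lemma open_trace_code:
  fixes L :: "('f, 'r) lang" and p :: "nat \<Rightarrow> 'u::metric_space" and B :: "('f, 'r, 'u) struct set"
  assumes cl: "countable_language L" and p: "dense_seq p" and B: "open B"
  shows "\<exists>V. open V \<and> (\<forall>M\<in>Mod L. M \<in> B \<longleftrightarrow> struct_code L p M \<in> V)"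
proof -
  let ?X = "pullback_topology (Mod L) (struct_code L p) euclidean"
  have L: "language L" using cl by (simp add: countable_language_def)
  have X: "topspace ?X = Mod L" by (simp add: topspace_pullback_topology)
  have sub: "openin ?X {M \<in> Mod L. c M \<in> W}" if c: "c \<in> coordinates L p" and W: "open W" for c W
  proof -
    obtain n where n: "\<And>M. struct_code L p M n = c M" by (rule coordinate_eq_code[OF cl c]) blast
    have "open ((\<lambda>y :: nat \<Rightarrow> real. y n) -` W)"
      using W by (intro open_vimage continuous_on_product_coordinates)
    moreover have "{M \<in> Mod L. c M \<in> W} = struct_code L p -` ((\<lambda>y. y n) -` W) \<inter> Mod L" by (auto simp: n)
    ultimately show ?thesis unfolding openin_pullback_topology open_openin[symmetric] by blast
  qed
  have "continuous_map ?X euclidean (\<lambda>M. fst M f x)" for f x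
  proof (cases "f \<in> Funs L \<and> x \<in> tuples (far L f) UNIV")
    case True
    then have f: "f \<in> Funs L" and x: "x \<in> tuples (far L f) UNIV" by auto
    show ?thesis
    proof (rule continuous_map_metricI)
      fix M0 :: "('f, 'r, 'u) struct" and \<epsilon> :: real assume "M0 \<in> topspace ?X" and \<epsilon>: "\<epsilon> > 0"
      then have M0: "M0 \<in> Mod L" by (simp add: X)
      \<comment> \<open>Quarters, because the comparison runs from \<open>M\<close> at
        \<open>x\<close> to \<open>M\<close> at \<open>?q\<close>, to \<open>p j\<close>, to
        \<open>M0\<close> at \<open>?q\<close>, to \<open>M0\<close> at \<open>x\<close>.\<close>
      obtain \<eta> where \<eta>: "\<eta> > 0" "\<And>(M :: ('f, 'r, 'u) struct) x y. M \<in> Mod L \<Longrightarrow>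
          x \<in> tuples (far L f) UNIV \<Longrightarrow> y \<in> tuples (far L f) UNIV \<Longrightarrow>
          (\<And>i. i < far L f \<Longrightarrow> dist (x i) (y i) < \<eta>) \<Longrightarrow> dist (fst M f x) (fst M f y) < \<epsilon> / 4"
        by (rule Mod_fun_uniform[OF L f, of "\<epsilon> / 4"]) (use \<epsilon> in auto)
      obtain "is" where len: "length is = far L f"
          and near: "\<And>i. i < far L f \<Longrightarrow> dist (x i) (tuple (map p is) i) < \<eta>"
        by (rule dense_tuple[OF p \<eta>(1), of "far L f" x]) blast
      let ?q = "tuple (map p is)"
      have q: "?q \<in> tuples (far L f) UNIV" using tuple_mem[of "map p is"] len by simp
      have close: "dist (fst M f x) (fst M f ?q) < \<epsilon> / 4" if "M \<in> Mod L" for M :: "('f, 'r, 'u) struct"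
        by (rule \<eta>(2)[OF that x q near])
      obtain j where j: "dist (fst M0 f ?q) (p j) < \<epsilon> / 4"
        using dense_seqD[OF p, of "\<epsilon> / 4"] \<epsilon> by auto
      let ?c = "fun_coordinate p f is j"
      have "?c \<in> coordinates L p" using f len unfolding coordinates_def by blast
      then have "openin ?X {M \<in> Mod L. ?c M \<in> {..<\<epsilon> / 4}}" by (intro sub) auto
      moreover have "dist (fst M f x) (fst M0 f x) < \<epsilon>" if "M \<in> {M \<in> Mod L. ?c M \<in> {..<\<epsilon> / 4}}" for M
      proof -
        have "dist (fst M f ?q) (p j) < \<epsilon> / 4" "dist (fst M f x) (fst M f ?q) < \<epsilon> / 4"
          using that close by (auto simp: fun_coordinate_def)
        with j close[OF M0] show ?thesis by metric
      qed
      ultimately show "\<exists>U. openin ?X U \<and> M0 \<in> U \<and> (\<forall>M\<in>U. dist (fst M f x) (fst M0 f x) < \<epsilon>)"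
        using M0 j by (intro exI[of _ "{M \<in> Mod L. ?c M \<in> {..<\<epsilon> / 4}}"]) (auto simp: fun_coordinate_def)
    qed
  next
    case False
    \<comment> \<open>Outside their domains extensional functions take the default value, the same
      for all structures, so these components are constant on \<open>Mod L\<close>.\<close>
    have const: "fst M f x = (if f \<in> Funs L then undefined else undefined x)"
      if "M \<in> Mod L" for M :: "('f, 'r, 'u) struct"
    proof (cases "f \<in> Funs L")
      case True
      then have "fst M f \<in> Unif (fmod L f) (far L f) UNIV"
        using that by (auto simp: Mod_def)
      then have "fst M f \<in> tuples (far L f) UNIV \<rightarrow>\<^sub>E UNIV"
        unfolding Unif_def by blast
      moreover have "x \<notin> tuples (far L f) UNIV" using False True by blast
      ultimately have "fst M f x = undefined" by (rule PiE_arb)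
      then show ?thesis using True by simp
    next
      case f: False
      have "fst M \<in> (\<Pi>\<^sub>E f\<in>Funs L. Unif (fmod L f) (far L f) UNIV)"
        using that by (auto simp: Mod_def)
      then have "fst M f = undefined" using f by (rule PiE_arb)
      then show ?thesis using f by simp
    qed
    show ?thesis
      by (rule continuous_map_eq[OF continuous_map_const[THEN iffD2]]) (auto simp: X const)
  qed
  then have "continuous_map ?X euclidean (\<lambda>M. fst M)"
    unfolding euclidean_product_topology[symmetric] continuous_map_componentwise_UNIV by blast
  moreover have "continuous_map ?X euclidean (\<lambda>M. snd M r x)" for r x
  proof (cases "r \<in> Rels L \<and> x \<in> tuples (rar L r) UNIV")
    case True
    then have r: "r \<in> Rels L" and x: "x \<in> tuples (rar L r) UNIV" by auto
    show ?thesis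
    proof (rule continuous_map_metricI)
      fix M0 :: "('f, 'r, 'u) struct" and \<epsilon> :: real assume "M0 \<in> topspace ?X" and \<epsilon>: "\<epsilon> > 0"
      then have M0: "M0 \<in> Mod L" by (simp add: X)
      obtain \<eta> where \<eta>: "\<eta> > 0" "\<And>(M :: ('f, 'r, 'u) struct) x y. M \<in> Mod L \<Longrightarrow>
          x \<in> tuples (rar L r) UNIV \<Longrightarrow> y \<in> tuples (rar L r) UNIV \<Longrightarrow>
          (\<And>i. i < rar L r \<Longrightarrow> dist (x i) (y i) < \<eta>) \<Longrightarrow> dist (snd M r x) (snd M r y) < \<epsilon> / 3"
        by (rule Mod_rel_uniform[OF L r, of "\<epsilon> / 3"]) (use \<epsilon> in auto)
      obtain "is" where len: "length is = rar L r"
          and near: "\<And>i. i < rar L r \<Longrightarrow> dist (x i) (tuple (map p is) i) < \<eta>"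
        by (rule dense_tuple[OF p \<eta>(1), of "rar L r" x]) blast
      let ?q = "tuple (map p is)"
      have q: "?q \<in> tuples (rar L r) UNIV" using tuple_mem[of "map p is"] len by simp
      have close: "dist (snd M r x) (snd M r ?q) < \<epsilon> / 3" if "M \<in> Mod L" for M :: "('f, 'r, 'u) struct"
        by (rule \<eta>(2)[OF that x q near])
      let ?c = "rel_coordinate p r is"
      have "?c \<in> coordinates L p" using r len unfolding coordinates_def by blast
      then have "openin ?X {M \<in> Mod L. ?c M \<in> ball (?c M0) (\<epsilon> / 3)}" by (intro sub) auto
      moreover have "dist (snd M r x) (snd M0 r x) < \<epsilon>"
        if "M \<in> {M \<in> Mod L. ?c M \<in> ball (?c M0) (\<epsilon> / 3)}" for M
      proof -
        have "dist (snd M0 r ?q) (snd M r ?q) < \<epsilon> / 3" "dist (snd M r x) (snd M r ?q) < \<epsilon> / 3"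
          using that close by (auto simp: rel_coordinate_def)
        with close[OF M0] show ?thesis by metric
      qed
      ultimately show "\<exists>U. openin ?X U \<and> M0 \<in> U \<and> (\<forall>M\<in>U. dist (snd M r x) (snd M0 r x) < \<epsilon>)"
        using M0 \<epsilon> by (intro exI[of _ "{M \<in> Mod L. ?c M \<in> ball (?c M0) (\<epsilon> / 3)}"]) auto
    qed
  next
    case False
    have const: "snd M r x = (if r \<in> Rels L then undefined else undefined x)"
      if "M \<in> Mod L" for M :: "('f, 'r, 'u) struct"
    proof (cases "r \<in> Rels L")
      case True
      then have "snd M r \<in> Unif (rmod L r) (rar L r) {0..1}"
        using that by (auto simp: Mod_def)
      then have "snd M r \<in> tuples (rar L r) UNIV \<rightarrow>\<^sub>E {0..1}"
        unfolding Unif_def by blast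
      moreover have "x \<notin> tuples (rar L r) UNIV" using False True by blast
      ultimately have "snd M r x = undefined" by (rule PiE_arb)
      then show ?thesis using True by simp
    next
      case r: False
      have "snd M \<in> (\<Pi>\<^sub>E r\<in>Rels L. Unif (rmod L r) (rar L r) {0..1})"
        using that by (auto simp: Mod_def)
      then have "snd M r = undefined" using r by (rule PiE_arb)
      then show ?thesis using r by simp
    qed
    show ?thesis
      by (rule continuous_map_eq[OF continuous_map_const[THEN iffD2]]) (auto simp: X const)
  qed
  then have "continuous_map ?X euclidean (\<lambda>M. snd M)"
    unfolding euclidean_product_topology[symmetric] continuous_map_componentwise_UNIV by blast
  ultimately have "continuous_map ?X euclidean (\<lambda>M. M)"
    unfolding prod_topology_euclidean[symmetric] continuous_map_pairwise o_def by blast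
  then have "openin ?X {M \<in> Mod L. M \<in> B}"
    using B by (auto simp: continuous_map_def X)
  then obtain V where "open V" "{M \<in> Mod L. M \<in> B} = struct_code L p -` V \<inter> Mod L"
    unfolding openin_pullback_topology by auto
  then show ?thesis by blast
qed

lemma borel_trace_code:
  fixes L :: "('f, 'r) lang" and p :: "nat \<Rightarrow> 'u::metric_space" and B :: "('f, 'r, 'u) struct set"
  assumes "countable_language L" and "dense_seq p" and B: "B \<in> sets borel"
  shows "\<exists>Z\<in>sets borel. \<forall>M\<in>Mod L. M \<in> B \<longleftrightarrow> struct_code L p M \<in> Z"
proof -
  have "B \<in> sigma_sets UNIV {S. open S}" using B by (simp add: borel_def)
  then show ?thesis
  proof induction
    case (Basic S)
    then show ?case using open_trace_code[OF assms(1,2), of S] borel_open by blast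
  next
    case Empty
    then show ?case by (intro bexI[of _ "{}"]) auto
  next
    case (Compl S)
    then obtain Z where "Z \<in> sets borel" "\<forall>M\<in>Mod L. M \<in> S \<longleftrightarrow> struct_code L p M \<in> Z" by blast
    then show ?case by (intro bexI[of _ "- Z"]) auto
  next
    case (Union S)
    then have "\<forall>i. \<exists>Z. Z \<in> sets borel \<and> (\<forall>M\<in>Mod L. M \<in> S i \<longleftrightarrow> struct_code L p M \<in> Z)" by blast
    from choice[OF this] obtain Z
      where "\<forall>i. Z i \<in> sets borel \<and> (\<forall>M\<in>Mod L. M \<in> S i \<longleftrightarrow> struct_code L p M \<in> Z i)" by (rule exE)
    then show ?case by (intro bexI[of _ "\<Union>i. Z i"]) auto
  qed
qed

text \<open>The sets with property \<open>P\<close> form a sigma-algebra that makes every coordinate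
  measurable, hence also the identity into the Borel space of sequences; so it contains all Borel
  sets.\<close>

lemma borel_sequence_induct [consumes 1, case_names basic empty compl union]:
  fixes Z :: "(nat \<Rightarrow> real) set"
  assumes "Z \<in> sets borel"
    and basic: "\<And>n a. P {y. y n < a}" and empty: "P {}"
    and compl: "\<And>Z. P Z \<Longrightarrow> P (- Z)" and union: "\<And>Z. (\<And>i::nat. P (Z i)) \<Longrightarrow> P (\<Union>i. Z i)"
  shows "P Z"
proof -
  interpret sigma_algebra UNIV "Collect P"
    unfolding sigma_algebra_iff2 using assms by (auto simp: Compl_eq_Diff_UNIV[symmetric] image_subset_iff)
  let ?M = "measure_of UNIV (Collect P) (\<lambda>_. 0)"
  have sets: "sets ?M = Collect P" by simp
  have "(\<lambda>y. y n) \<in> borel_measurable ?M" for n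
    unfolding borel_measurable_iff_less using basic by (simp add: sets)
  then have "(\<lambda>y. y) \<in> borel_measurable ?M"
    by (rule measurable_coordinatewise_then_product)
  from measurable_sets[OF this assms(1)] show ?thesis by (simp add: sets)
qed

subsection \<open>Invariant Borel sets\<close>

lemma act_in_Mod:
  assumes M: "M \<in> Mod L" and g: "g \<in> Iso"
  shows "act L g M \<in> Mod L"
proof -
  have pull: "pull g n x \<in> tuples n UNIV" for n x by (auto simp: pull_def)
  have "max_dist n (pull g n x) (pull g n y) = max_dist n x y" for n x y
    unfolding max_dist_def pull_def using inv_in_Iso[OF g]
    by (intro arg_cong[of _ _ Max] arg_cong[of _ _ "insert 0"] image_cong) (auto simp: Iso_dist)
  then have f: "dist (fst M f (pull g (far L f) x)) (fst M f (pull g (far L f) y)) \<le> fmod L f (max_dist (far L f) x y)"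
      if "f \<in> Funs L" for f x y
    using Mod_fun_dist[OF M that pull pull, of x y] by simp
  have r: "dist (snd M r (pull g (rar L r) x)) (snd M r (pull g (rar L r) y)) \<le> rmod L r (max_dist (rar L r) x y)"
      if "r \<in> Rels L" for r x y
    using Mod_rel_dist[OF M that pull pull, of x y] \<open>\<And>n x y. max_dist n (pull g n x) (pull g n y) = max_dist n x y\<close> by simp
  have r01: "snd M r (pull g (rar L r) x) \<in> {0..1}" if "r \<in> Rels L" for r x
  proof -
    have "snd M r \<in> Unif (rmod L r) (rar L r) {0..1}" using M that by (auto simp: Mod_def)
    then show ?thesis using pull[of "rar L r" x] unfolding Unif_def by blast
  qed
  show ?thesis
    unfolding act_def Mod_def Unif_def
    using f r r01 by (auto simp: Iso_dist[OF g] simp del: atLeastAtMost_iff)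
qed

text \<open>The property of Baire is carried through the same induction because the complement step
  needs it for the set being complemented.\<close>

lemma vaught_definable_code:
  fixes L :: "('f, 'r) lang" and p :: "nat \<Rightarrow> 'u::polish_space"
  assumes L: "language L" and U: "urysohn_sphere TYPE('u)" and p: "dense_seq p"
    and Z: "Z \<in> sets borel"
  shows "vaught_definable L p (struct_code L p -` Z)"
proof -
  from Z have "vaught_definable L p (struct_code L p -` Z) \<and>
    (\<forall>M\<in>Mod L. almost_open (Iso_top p) {g \<in> Iso. act L g M \<in> struct_code L p -` Z})"
  proof (induction rule: borel_sequence_induct)
    case (basic n a)
    have c: "atomic_coordinate L p (\<lambda>M. struct_code L p M n)"
      by (rule atomic_coordinates[OF L code_in_coordinates])
    have "struct_code L p -` {y. y n < a} = {M. struct_code L p M n < a}" by auto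
    then show ?case
      using vaught_definable_atomic_coordinate[OF p U c] openin_atomic_coordinate[OF p c]
      by (simp add: openin_imp_almost_open)
  next
    case empty
    \<comment> \<open>The empty set as a strict sublevel set of the constant coordinate.\<close>
    have "vaught_definable L p {M :: ('f, 'r, 'u) struct. 0 < (0 :: real)}"
      by (rule vaught_definable_atomic_coordinate[OF p U atomic_zero_coordinate])
    then show ?case by (simp add: openin_imp_almost_open)
  next
    case (compl Z)
    then have "vaught_definable L p (- (struct_code L p -` Z))"
      by (intro vaught_definable_Compl p U) auto
    moreover have "almost_open (Iso_top p) {g \<in> Iso. act L g M \<in> struct_code L p -` (- Z)}" if "M \<in> Mod L" for M
    proof -
      have "almost_open (Iso_top p) (Iso - {g \<in> Iso. act L g M \<in> struct_code L p -` Z})"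
        using almost_open_compl[of "Iso_top p"] compl that by simp
      moreover have "Iso - {g \<in> Iso. act L g M \<in> struct_code L p -` Z} = {g \<in> Iso. act L g M \<in> struct_code L p -` (- Z)}"
        by auto
      ultimately show ?thesis by simp
    qed
    ultimately show ?case by (simp add: vimage_Compl)
  next
    case (union Z)
    then have "vaught_definable L p (\<Union>i. struct_code L p -` Z i)"
      by (intro vaught_definable_UN) auto
    moreover have "almost_open (Iso_top p) {g \<in> Iso. act L g M \<in> struct_code L p -` (\<Union>i. Z i)}" if "M \<in> Mod L" for M
    proof -
      have "almost_open (Iso_top p) (\<Union>i. {g \<in> Iso. act L g M \<in> struct_code L p -` Z i})"
        using union that by (intro almost_open_UN) auto
      moreover have "(\<Union>i. {g \<in> Iso. act L g M \<in> struct_code L p -` Z i}) = {g \<in> Iso. act L g M \<in> struct_code L p -` (\<Union>i. Z i)}"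
        by auto
      ultimately show ?thesis by simp
    qed
    ultimately show ?case by (simp add: vimage_UN)
  qed
  then show ?thesis ..
qed

text \<open>With \<open>N = k = 0\<close> the distance condition is vacuous, and invariance makes
  the set of \<open>g\<close> with \<open>gM \<in> B\<close> either the whole group, which is
  nonmeager, or empty. The zero modulus is recorded so that countably many such sentences can be
  combined later.\<close>

lemma invariant_set_sentence:
  fixes L :: "('f, 'r) lang" and B :: "('f, 'r, 'u::polish_space) struct set"
  assumes L: "countable_language L" and U: "urysohn_sphere TYPE('u)" and B: "B \<in> sets borel"
    and inv: "\<And>g M. g \<in> Iso \<Longrightarrow> M \<in> Mod L \<Longrightarrow> act L g M \<in> B \<longleftrightarrow> M \<in> B"
  shows "\<exists>\<phi>. sentence L \<phi> \<and> (\<forall>t\<ge>0. fm_mod L \<phi> (\<lambda>_. t) = 0) \<and>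
    (\<forall>M\<in>Mod L. \<forall>e. fm_val M \<phi> e = (if M \<in> B then 0 else 1))"
proof -
  obtain p :: "nat \<Rightarrow> 'u" where p: "dense_seq p" using ex_dense_seq by blast
  obtain Z where Z: "Z \<in> sets borel" "\<And>M. M \<in> Mod L \<Longrightarrow> M \<in> B \<longleftrightarrow> struct_code L p M \<in> Z"
    using borel_trace_code[OF L p B] by blast
  have "vaught_definable L p (struct_code L p -` Z)"
    using L by (intro vaught_definable_code U p Z) (simp add: countable_language_def)
  then obtain \<phi> where \<phi>: "vaught_formula L p (struct_code L p -` Z) 0 0 (\<lambda>_. 0) \<phi>"
    unfolding vaught_definable_def by blast
  have nm: "\<not> meager (Iso_top p) Iso"
    using open_not_meager[OF completely_metrizable_Iso_top[OF p] openin_topspace] id_in_Iso by auto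
  have "fm_val M \<phi> e = (if M \<in> B then 0 else 1)" if M: "M \<in> Mod L" for M :: "('f, 'r, 'u) struct" and e
  proof -
    have b: "0 \<le> fm_val M \<phi> e" "fm_val M \<phi> e \<le> 1"
      using \<phi> M by (auto simp: vaught_formula_def)
    have "fm_val M \<phi> e < r \<longleftrightarrow> \<not> meager (Iso_top p) {g \<in> Iso. act L g M \<in> struct_code L p -` Z}"
      if "0 < r" "r \<le> 1" for r
      using \<phi> M that by (simp add: vaught_formula_def)
    moreover have "{g \<in> Iso. act L g M \<in> struct_code L p -` Z} = (if M \<in> B then Iso else {})"
      using Z(2) act_in_Mod[OF M] inv[OF _ M] by auto
    ultimately have less: "fm_val M \<phi> e < r \<longleftrightarrow> M \<in> B" if "0 < r" "r \<le> 1" for r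
      using that nm by simp
    show ?thesis
    proof (cases "M \<in> B")
      case True
      then have "\<not> 0 < fm_val M \<phi> e" using less[of "fm_val M \<phi> e"] b by (metis less_irrefl)
      then have "fm_val M \<phi> e = 0" using b by linarith
      then show ?thesis using True by simp
    next
      case False
      then show ?thesis using less[of 1] b by simp
    qed
  qed
  moreover have "sentence L \<phi>" using \<phi> by (auto simp: vaught_formula_def sentence_def)
  moreover have "fm_mod L \<phi> (\<lambda>_. t) = 0" if "t \<ge> 0" for t
    using \<phi> that unfolding vaught_formula_def by fastforce
  ultimately show ?thesis by blast
qed

theorem theorem1p1:
  fixes L :: "('f, 'r) lang"
    and A :: "('f, 'r, 'u::polish_space) struct \<Rightarrow> real"
  assumes "countable_language L"
    and "urysohn_sphere TYPE('u)"
    and "borel_grey_subset (Mod L) A"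
    and "\<forall>g\<in>Iso. \<forall>M\<in>Mod L. A (act L g M) = A M"
  shows "\<exists>\<phi>. sentence L \<phi> \<and> (\<forall>M\<in>Mod L. \<forall>e. A M = fm_val M \<phi> e)"
proof -
  have A01: "0 \<le> A M" "A M \<le> 1" if "M \<in> Mod L" for M
    using assms(3) that by (auto simp: borel_grey_subset_def)
  have "\<exists>\<phi>. sentence L \<phi> \<and> (\<forall>t\<ge>0. fm_mod L \<phi> (\<lambda>_. t) = 0) \<and>
      (\<forall>M\<in>Mod L. \<forall>e. fm_val M \<phi> e = (if A M < q then 0 else 1))" for q
  proof -
    have "A -` {..<q} \<inter> space (restrict_space borel (Mod L)) \<in> sets (restrict_space borel (Mod L))"
      using assms(3) by (intro measurable_sets) (auto simp: borel_grey_subset_def)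
    then obtain B where B: "B \<in> sets borel" "A -` {..<q} \<inter> Mod L = Mod L \<inter> B"
      by (auto simp: sets_restrict_space space_restrict_space)
    have iff: "M \<in> B \<longleftrightarrow> A M < q" if "M \<in> Mod L" for M using B(2) that by auto
    have "act L g M \<in> B \<longleftrightarrow> M \<in> B" if "g \<in> Iso" "M \<in> Mod L" for g M
      using that assms(4) by (simp add: iff act_in_Mod)
    from invariant_set_sentence[OF assms(1,2) B(1) this] show ?thesis
      by (simp add: iff cong: ball_cong)
  qed
  then obtain \<Phi> where \<Phi>: "\<And>q. sentence L (\<Phi> q)" "\<And>q t. 0 \<le> t \<Longrightarrow> fm_mod L (\<Phi> q) (\<lambda>_. t) = 0"
      "\<And>q M e. M \<in> Mod L \<Longrightarrow> fm_val M (\<Phi> q) e = (if A M < q then 0 else 1)"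
    by metis
  \<comment> \<open>The number 1 is left out because of the division by \<open>1 - q\<close>. Where
    \<open>A\<close> is 1, every term of the infimum is 1.\<close>
  define D where "D = \<rat> \<inter> {0..<1::real}"
  have D: "countable D" "0 \<in> D" by (auto simp: D_def countable_rat)
  define q where "q = from_nat_into D"
  have "q n \<in> D" for n
    using from_nat_into[of D n] D(2) unfolding q_def by blast
  then have q: "0 \<le> q n" "q n < 1" for n
    by (auto simp: D_def)
  \<comment> \<open>chosen to have the value \<open>q n + (1 - q n) * \<Phi> (q n)\<close>\<close>
  define ps where "ps n = wsum [(1 - q n, - q n / (1 - q n), \<Phi> (q n))]" for n
  have val: "fm_val M (ps n) e = (if A M < q n then q n else 1)" if "M \<in> Mod L" for M n e
  proof -
    have nonneg: "0 \<le> q n / (1 - q n)" using q[of n] by simp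
    have "\<bar>q n / (1 - q n)\<bar> = q n / (1 - q n)" "\<bar>1 + q n / (1 - q n)\<bar> = 1 + q n / (1 - q n)"
      using nonneg by (intro abs_of_nonneg add_nonneg_nonneg; simp)+
    moreover have "(1 - q n) * (q n / (1 - q n)) = q n" "(1 - q n) * (1 + q n / (1 - q n)) = 1"
      using q[of n] by (simp_all add: distrib_left)
    ultimately have "(1 - q n) * \<bar>q n / (1 - q n)\<bar> = q n" "(1 - q n) * \<bar>1 + q n / (1 - q n)\<bar> = 1"
      by simp_all
    then show ?thesis
      using q[of n] by (simp add: ps_def fm_val_wsum \<Phi>(3)[OF that] del: abs_divide times_divide_eq_right)
  qed
  have fm: "formula L (ps n)" "fv (ps n) \<subseteq> {}" for n
    using \<Phi>(1)[of "q n"] q[of n] by (auto simp: ps_def sentence_def fv_wsum intro!: formula_wsum)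
  have md: "0 \<le> fm_mod L (ps n) (\<lambda>_. t) \<and> fm_mod L (ps n) (\<lambda>_. t) \<le> 0 * t" if "0 \<le> t" for n t
    using fm_mod_wsum[of "[(1 - q n, - q n / (1 - q n), \<Phi> (q n))]" L "\<lambda>_. t"] \<Phi>(2)[OF that] q[of n]
    by (simp add: ps_def)
  have "sentence L (InfN ps)"
    using formula_InfN_linear(1,2)[OF fm _ _ md] by (auto simp: sentence_def simp del: fv.simps)
  moreover have "A M = fm_val M (InfN ps) e" if M: "M \<in> Mod L" for M e
  proof (rule antisym)
    have nonneg: "0 \<le> fm_val M (ps n) e" for n using q[of n] by (simp add: val[OF M])
    have "\<not> fm_val M (ps n) e < A M" for n using A01[OF M] by (simp add: val[OF M])
    then show "A M \<le> fm_val M (InfN ps) e"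
      by (intro leI) (simp only: fm_val_InfN_less[OF nonneg] not_ex not_False_eq_True simp_thms)
    show "fm_val M (InfN ps) e \<le> A M"
    proof (rule ccontr)
      assume "\<not> ?thesis"
      then have less: "A M < fm_val M (InfN ps) e" by simp
      also have "\<dots> \<le> 1"
        by (rule fm_val_InfN_bounds(2)[OF nonneg]) (use q in \<open>auto simp: val[OF M] less_imp_le\<close>)
      finally have "A M < 1" .
      \<comment> \<open>A rational strictly between \<open>A M\<close> and the infimum indexes a
        term of value \<open>s\<close>, which is below the infimum.\<close>
      with less obtain s where s: "s \<in> \<rat>" "A M < s" "s < min 1 (fm_val M (InfN ps) e)"
        using Rats_dense_in_real[of "A M" "min 1 (fm_val M (InfN ps) e)"] by auto
      then have "s \<in> D" using A01[OF M] by (auto simp: D_def)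
      then obtain n where "q n = s" using from_nat_into_surj[OF D(1)] by (auto simp: q_def)
      then have "fm_val M (ps n) e < fm_val M (InfN ps) e" using s by (simp add: val[OF M])
      then have "fm_val M (InfN ps) e < fm_val M (InfN ps) e"
        unfolding fm_val_InfN_less[OF nonneg] by (rule exI)
      then show False by simp
    qed
  qed
  ultimately show ?thesis by blast
qed

end
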